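(* Let $N\ge2$, $M\ge0$, and let $\mathbf{c}=(c_1,\dots,c_N)\in\mathbb{C}^N$, $\mu_a=q^{-c_a}$. For generic $\Lambda\in\mathbb{C}$, let $R_{\mathbf i,\mathbf j}(\Lambda)$ ($\mathbf i,\mathbf j\in I_M$) be the coefficients defined by $$B_{1,\mathbf i}(\mathbf z,\Lambda)=\sum_{\mathbf j\in I_M}R_{\mathbf i,\mathbf j}(\Lambda)\,B_{2,\mathbf j}(\mathbf z,\Lambda).$$ Then for $\mathbf i,\mathbf j\in I_M$, $$R_{\mathbf i,\mathbf j}(\Lambda)=C\,\frac{(\Lambda q^{-|\mathbf c|};q)_M}{(\Lambda q^{-M+1};q)_M}\prod_{a=1}^N\frac{(q;q)_{i_a}}{(q;q)_{j_a}}\;A^{\mathbf c-\mathbf i,\mathbf i}_{\mathbf c-\mathbf j,\mathbf j},$$ $$C=(-1)^M q^{\frac{M(|\mathbf c|-M+1)}{2}+\frac12\sum_{a=1}^N\left(\binom{i_a}{2}-\binom{j_a}{2}\right)+\frac{\mathbf c\cdot(\mathbf j-2\mathbf i)}{2}+\frac{\langle\mathbf j-\mathbf i,\mathbf c\rangle}{2}},$$ where, for $\mathbf a+\mathbf b=\mathbf i'+\mathbf j'=\mathbf c$ with $\mathbf b,\mathbf j'\in I_M$, $$A^{\mathbf a,\mathbf b}_{\mathbf i',\mathbf j'}=q^{\frac{\langle\mathbf i',\mathbf j'\rangle-\langle\mathbf b,\mathbf a\rangle}{2}}\sum_{\mathbf k\in\mathbb{Z}^{N-1}}\Phi_q\big(\mathbf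 k\,|\,\overline{\mathbf j'};\tfrac1\Lambda,q^{-M}\big)\,\Phi_q\big(\overline{\mathbf a}-\mathbf k\,|\,\overline{\mathbf c}-\mathbf k;\Lambda q^{M-|\mathbf c|},\Lambda q^{-|\mathbf c|}\big).$$
   Context: Let $0<|q|<1$, fix a logarithm of $q$ and put $q^x=e^{x\log q}$. $(x;q)_n=\prod_{k=0}^{n-1}(1-xq^k)$. $I_M=\{\mathbf i=(i_1,\dots,i_N)\in\mathbb{Z}_{\ge0}^N: i_1+\cdots+i_N=M\}$. For variables $\mathbf z=(z_1,\dots,z_N)$ and a free parameter $\Lambda$ put $z_{N+1}=\Lambda z_1$ and $$B_{1,\mathbf i}(\mathbf z,\Lambda)=\prod_{a=1}^N\Big(\mu_a\frac{z_{a+1}}{z_a};q\Big)_{i_a}z_a^{i_a},\qquad B_{2,\mathbf i}(\mathbf z,\Lambda)=\prod_{a=1}^N\Big(\frac{z_a}{z_{a+1}};q\Big)_{i_a}z_{a+1}^{i_a}.$$ These are homogeneous polynomials of degree $M$ in $z_1,\dots,z_N$; for generic $\Lambda$ the family $\{B_{2,\mathbf i}\}_{\mathbf i\in I_M}$ is a basis of the space of such polynomials, so the $R_{\mathbf i,\mathbf j}(\Lambda)$ are well defined. For sequences $\mathbf i,\mathbf j$ of length $n$: $|\mathbf i|=\sum_a i_a$, $\overline{\mathbf i}=(i_1,\dots,i_{n-1})$, $\langle\mathbf i,\mathbf j\rangle=\sum_{1\le a<b\le n}i_aj_b$, $\mathbf i\cdot\mathbf j=\sum_a i_aj_a$. For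 $\boldsymbol\beta,\boldsymbol\gamma\in\mathbb{Z}^n$, $$\Phi_q(\boldsymbol\gamma|\boldsymbol\beta;\lambda,\mu)=q^{\langle\boldsymbol\beta-\boldsymbol\gamma,\boldsymbol\gamma\rangle}\Big(\frac\mu\lambda\Big)^{|\boldsymbol\gamma|}\frac{(\lambda;q)_{|\boldsymbol\gamma|}(\frac\mu\lambda;q)_{|\boldsymbol\beta|-|\boldsymbol\gamma|}}{(\mu;q)_{|\boldsymbol\beta|}}\prod_{a=1}^n\frac{(q;q)_{\beta_a}}{(q;q)_{\gamma_a}(q;q)_{\beta_a-\gamma_a}},$$ where the $q$-binomial coefficient is $0$ unless $0\le\gamma_a\le\beta_a$. When $\lambda=\mu q^M$ and $\boldsymbol\beta,\boldsymbol\gamma\in\mathbb{C}^n$ with $\boldsymbol\beta-\boldsymbol\gamma\in\mathbb{Z}_{\ge0}^n$ (as needed for the second factor when $\mathbf c\in\mathbb{C}^N$), $\Phi_q$ is understood by analytic continuation as $$\Phi_q(\boldsymbol\gamma|\boldsymbol\beta;\mu q^M,\mu)=q^{\langle\boldsymbol\beta-\boldsymbol\gamma,\boldsymbol\gamma\rangle-M|\boldsymbol\gamma|}\frac{(\mu q^{|\boldsymbol\gamma|};q)_M}{(\mu;q)_M}\frac{(q^{-M};q)_{|\boldsymbol\beta|-|\boldsymbol\gamma|}}{(\mu q^{|\boldsymbol\gamma|};q)_{|\boldsymbol\beta|-|\boldsymbol\gamma|}}\prod_{a=1}^n\frac{(q^{\gamma_a+1};q)_{\beta_a-\gamma_a}}{(q;q)_{\beta_a-\gamma_a}}.$$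 The sum over $\mathbf k$ is finite, since the first factor vanishes unless $0\le k_a\le j'_a$. *)

theory Defs
  imports "HOL-Analysis.Analysis"
begin

text \<open>
  A sequence of length \<open>n\<close> is a function on \<open>nat\<close> of which only the values at \<open>1, \<dots>, n\<close> are
  used. Hence \<open>(i\<^sub>1, \<dots>, i\<^sub>N)\<close> with its last entry dropped is the same function, read with
  length \<open>N - 1\<close>. Throughout, \<open>l\<close> is the chosen logarithm of \<open>q\<close>, that is \<open>q = exp l\<close>.
\<close>

definition qpow :: "complex \<Rightarrow> complex \<Rightarrow> complex" where
  "qpow l x = exp (x * l)"

definition qpoch :: "complex \<Rightarrow> complex \<Rightarrow> nat \<Rightarrow> complex" where
  "qpoch x q n = (\<Prod>k<n. 1 - x * q ^ k)"

definition pairing :: "nat \<Rightarrow> (nat \<Rightarrow> 'a::comm_ring_1) \<Rightarrow> (nat \<Rightarrow> 'a) \<Rightarrow> 'a" where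
  "pairing n i j = (\<Sum>b=1..n. \<Sum>a=1..<b. i a * j b)"

text \<open>
  The index sets \<open>I\<^sub>M\<close> and \<open>\<int>\<^sup>n\<close>; the value \<open>0\<close> outside \<open>{1..n}\<close> makes each sequence
  occur exactly once.
\<close>

definition index_set :: "nat \<Rightarrow> nat \<Rightarrow> (nat \<Rightarrow> nat) set" where
  "index_set N M = {i. (\<forall>a. a \<notin> {1..N} \<longrightarrow> i a = 0) \<and> (\<Sum>a=1..N. i a) = M}"

definition int_seqs :: "nat \<Rightarrow> (nat \<Rightarrow> int) set" where
  "int_seqs n = {k. \<forall>a. a \<notin> {1..n} \<longrightarrow> k a = 0}"

text \<open>
  The cyclic extension \<open>z\<^bsub>N+1\<^esub> = \<Lambda> z\<^sub>1\<close>. The formulas for \<open>B1\<close> and \<open>B2\<close> divide by the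
  \<open>z\<^sub>a\<close>, so they give the values of the polynomials only where no \<open>z\<^sub>a\<close> vanishes
  (and \<open>\<Lambda> \<noteq> 0\<close> for \<open>B2\<close>).
\<close>

definition zext :: "nat \<Rightarrow> complex \<Rightarrow> (nat \<Rightarrow> complex) \<Rightarrow> nat \<Rightarrow> complex" where
  "zext N \<Lambda> z a = (if a = N + 1 then \<Lambda> * z 1 else z a)"

definition B1 :: "complex \<Rightarrow> nat \<Rightarrow> (nat \<Rightarrow> complex) \<Rightarrow> (nat \<Rightarrow> nat) \<Rightarrow>
    (nat \<Rightarrow> complex) \<Rightarrow> complex \<Rightarrow> complex" where
  "B1 q N \<mu> i z \<Lambda> =
     (\<Prod>a=1..N. qpoch (\<mu> a * (zext N \<Lambda> z (a + 1) / zext N \<Lambda> z a)) q (i a)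
       * zext N \<Lambda> z a ^ i a)"

definition B2 :: "complex \<Rightarrow> nat \<Rightarrow> (nat \<Rightarrow> nat) \<Rightarrow>
    (nat \<Rightarrow> complex) \<Rightarrow> complex \<Rightarrow> complex" where
  "B2 q N i z \<Lambda> =
     (\<Prod>a=1..N. qpoch (zext N \<Lambda> z a / zext N \<Lambda> z (a + 1)) q (i a)
       * zext N \<Lambda> z (a + 1) ^ i a)"

text \<open>
  \<open>\<Phi>\<^sub>q(\<gamma>|\<beta>; \<lambda>, \<mu>)\<close> for integer sequences of length \<open>n\<close>. It is zero unless
  \<open>0 \<le> \<gamma>\<^sub>a \<le> \<beta>\<^sub>a\<close> for all \<open>a\<close>, because of the \<open>q\<close>-binomial coefficients, and otherwise
  every length passed through \<open>nat\<close> is nonnegative.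
\<close>

definition Phi :: "complex \<Rightarrow> nat \<Rightarrow> (nat \<Rightarrow> int) \<Rightarrow> (nat \<Rightarrow> int) \<Rightarrow>
    complex \<Rightarrow> complex \<Rightarrow> complex" where
  "Phi q n \<gamma> \<beta> lam \<mu> =
     (if \<forall>a\<in>{1..n}. 0 \<le> \<gamma> a \<and> \<gamma> a \<le> \<beta> a then
        q powi (pairing n (\<lambda>a. \<beta> a - \<gamma> a) \<gamma>)
        * (\<mu> / lam) powi (\<Sum>a=1..n. \<gamma> a)
        * (qpoch lam q (nat (\<Sum>a=1..n. \<gamma> a))
           * qpoch (\<mu> / lam) q (nat ((\<Sum>a=1..n. \<beta> a) - (\<Sum>a=1..n. \<gamma> a)))
           / qpoch \<mu> q (nat (\<Sum>a=1..n. \<beta> a)))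
        * (\<Prod>a=1..n. qpoch q q (nat (\<beta> a))
            / (qpoch q q (nat (\<gamma> a)) * qpoch q q (nat (\<beta> a - \<gamma> a))))
      else 0)"

text \<open>
  The analytic continuation of \<open>\<Phi>\<^sub>q(\<gamma>|\<beta>; \<mu> q\<^sup>M, \<mu>)\<close> to complex \<open>\<beta>\<close>, \<open>\<gamma>\<close> with
  \<open>\<beta>\<^sub>a - \<gamma>\<^sub>a\<close> a nonnegative integer for all \<open>a\<close>. Here \<open>inv of_nat x\<close> is the natural number
  equal to the complex number \<open>x\<close>.
\<close>

definition Phi_cont :: "complex \<Rightarrow> complex \<Rightarrow> nat \<Rightarrow> nat \<Rightarrow> (nat \<Rightarrow> complex) \<Rightarrow>
    (nat \<Rightarrow> complex) \<Rightarrow> complex \<Rightarrow> complex" where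
  "Phi_cont q l n M \<gamma> \<beta> \<mu> =
     (let d = (\<lambda>a. inv (of_nat :: nat \<Rightarrow> complex) (\<beta> a - \<gamma> a));
          D = (\<Sum>a=1..n. d a);
          G = (\<Sum>a=1..n. \<gamma> a)
      in qpow l (pairing n (\<lambda>a. \<beta> a - \<gamma> a) \<gamma> - of_nat M * G)
         * (qpoch (\<mu> * qpow l G) q M / qpoch \<mu> q M)
         * (qpoch (q powi (- int M)) q D / qpoch (\<mu> * qpow l G) q D)
         * (\<Prod>a=1..n. qpoch (qpow l (\<gamma> a + 1)) q (d a) / qpoch q q (d a)))"

text \<open>
  \<open>Acoef\<close> is \<open>A\<close> with upper indices \<open>a, b\<close> and lower indices \<open>i, j\<close>, where \<open>a + b = i + j\<close> is
  the sequence \<open>c\<close>. In the second factor the parameters are \<open>\<mu> = \<Lambda> q\<^bsup>-|c|\<^esup>\<close> and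
  \<open>\<Lambda> q\<^bsup>M-|c|\<^esup> = \<mu> q\<^sup>M\<close>. The sum has only finitely many nonzero terms.
\<close>

definition Acoef :: "complex \<Rightarrow> complex \<Rightarrow> nat \<Rightarrow> nat \<Rightarrow> complex \<Rightarrow>
    (nat \<Rightarrow> complex) \<Rightarrow> (nat \<Rightarrow> nat) \<Rightarrow> (nat \<Rightarrow> complex) \<Rightarrow> (nat \<Rightarrow> nat) \<Rightarrow> complex" where
  "Acoef q l N M \<Lambda> a b i j =
     (let c = (\<lambda>s. a s + of_nat (b s))
      in qpow l ((pairing N i (\<lambda>s. of_nat (j s)) - pairing N (\<lambda>s. of_nat (b s)) a) / 2)
         * (\<Sum>\<^sub>\<infinity>k\<in>int_seqs (N - 1).
              Phi q (N - 1) k (\<lambda>s. int (j s)) (1 / \<Lambda>) (q powi (- int M))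
              * Phi_cont q l (N - 1) M (\<lambda>s. a s - of_int (k s)) (\<lambda>s. c s - of_int (k s))
                  (\<Lambda> * qpow l (- (\<Sum>s=1..N. c s)))))"

definition Cfactor :: "complex \<Rightarrow> nat \<Rightarrow> nat \<Rightarrow> (nat \<Rightarrow> complex) \<Rightarrow>
    (nat \<Rightarrow> nat) \<Rightarrow> (nat \<Rightarrow> nat) \<Rightarrow> complex" where
  "Cfactor l N M c i j =
     (- 1) ^ M * qpow l (of_nat M * ((\<Sum>a=1..N. c a) - of_nat M + 1) / 2
       + (\<Sum>a=1..N. of_nat (i a choose 2) - of_nat (j a choose 2)) / 2
       + (\<Sum>a=1..N. c a * (of_nat (j a) - 2 * of_nat (i a))) / 2
       + pairing N (\<lambda>a. of_nat (j a) - of_nat (i a)) c / 2)"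

end

theory Submission
  imports Defs "HOL-Library.Function_Algebras"
begin

text \<open>
  Both families are evaluated at the points \<open>z\<^sup>(\<^sup>k\<^sup>)\<close> with
  \<open>z\<^sub>a = q\<^bsup>k\<^sub>1 + \<dots> + k\<^bsub>a-1\<^esub>\<^esup>\<close>, for \<open>k \<in> \<nat>\<^bsup>N-1\<^esup>\<close>. Up to a power of \<open>q\<close> and a
  factor independent of \<open>k\<close>, the second \<open>\<Phi>\<close>-factor of \<open>A\<close> is \<open>B\<^sub>1\<^sub>,\<^sub>i(z\<^sup>(\<^sup>k\<^sup>))\<close>. The first
  \<open>\<Phi>\<close>-factor is, up to a factor depending on \<open>j\<close> alone, the inverse of the matrix
  \<open>B\<^sub>2\<^sub>,\<^sub>j(z\<^sup>(\<^sup>k\<^sup>))\<close>, which is triangular in \<open>k\<close> and \<open>j\<close>; this orthogonality is the case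
  \<open>x y = 1\<close> of a multiple \<open>q\<close>-Vandermonde sum. So the formula for \<open>R\<close> is what one gets by
  evaluating the expansion at the points \<open>z\<^sup>(\<^sup>k\<^sup>)\<close> and inverting. The inverse also shows that the
  \<open>B\<^sub>2\<^sub>,\<^sub>j\<close> are linearly independent, and since there are as many of them as monomials of degree
  \<open>M\<close>, they span the forms of degree \<open>M\<close>.
\<close>

subsection \<open>The \<open>q\<close>-Pochhammer symbol\<close>

lemma qpoch_0 [simp]: "qpoch x q 0 = 1"
  by (simp add: qpoch_def)

lemma qpoch_Suc: "qpoch x q (Suc n) = qpoch x q n * (1 - x * q ^ n)"
  by (simp add: qpoch_def)

lemma qpoch_add: "qpoch x q (m + n) = qpoch x q m * qpoch (x * q ^ m) q n"
  by (induction n) (simp_all add: qpoch_Suc power_add mult_ac)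

lemma qpoch_qq_nonzero:
  assumes "norm q < 1"
  shows "qpoch q q n \<noteq> 0"
proof
  assume "qpoch q q n = 0"
  then obtain k where "q * q ^ k = 1"
    by (auto simp: qpoch_def)
  then have "norm q * norm q ^ k = 1"
    by (metis norm_one norm_power norm_mult)
  moreover have "norm q * norm q ^ k \<le> norm q * 1"
    using assms by (intro mult_left_mono power_le_one) auto
  ultimately show False using assms by simp
qed

text \<open>Reversal of the order of the factors: the hypothesis says y = q^(1-n)/x, so factor n-1-t
  on the left is -x q^(n-1-t) times factor t of \<open>qpoch y q n\<close>. The exponents of q add
  up to n choose 2.\<close>

lemma qpoch_reflect:
  assumes "x * y * q ^ n = q" and "q \<noteq> 0"
  shows "qpoch x q n = (- x) ^ n * q ^ (n choose 2) * qpoch y q n"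
proof -
  have *: "1 - x * q ^ (n - Suc t) = - x * q ^ (n - Suc t) * (1 - y * q ^ t)" if tn: "t < n" for t
  proof -
    obtain m where n: "n = Suc (t + m)"
      using less_imp_Suc_add[OF tn] by auto
    have "q * (x * y * (q ^ m * q ^ t)) = q * 1"
      using assms(1) unfolding n by (simp add: power_add mult_ac)
    then have "x * y * (q ^ m * q ^ t) = 1"
      using assms(2) mult_left_cancel by blast
    then show ?thesis unfolding n by (simp add: algebra_simps)
  qed
  have "qpoch x q n = (\<Prod>t<n. 1 - x * q ^ (n - Suc t))"
    unfolding qpoch_def by (rule prod.nat_diff_reindex[symmetric])
  also have "\<dots> = (\<Prod>t<n. - x * q ^ (n - Suc t) * (1 - y * q ^ t))"
    by (intro prod.cong refl *) auto
  also have "\<dots> = (- x) ^ n * (\<Prod>t<n. q ^ (n - Suc t)) * qpoch y q n"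
    by (simp only: prod.distrib qpoch_def prod_constant card_lessThan)
  also have "(\<Prod>t<n. q ^ (n - Suc t)) = (\<Prod>t<n. q ^ t)"
    by (rule prod.nat_diff_reindex)
  also have "\<dots> = q ^ (n choose 2)"
    by (simp only: power_sum[symmetric] lessThan_atLeast0 Sum_Ico_nat choose_two) simp
  finally show ?thesis .
qed

section \<open>Gaussian binomials and the one-dimensional q-Vandermonde sum\<close>

definition qbin :: "complex \<Rightarrow> nat \<Rightarrow> nat \<Rightarrow> complex" where
  "qbin q n k = qpoch q q n / (qpoch q q k * qpoch q q (n - k))"

lemma qbin_0_and_self:
  assumes "norm q < 1" shows "qbin q n 0 = 1" "qbin q n n = 1"
  using qpoch_qq_nonzero[OF assms] by (simp_all add: qbin_def)

text \<open>The q-Pascal rule, from 1 - u v = (1 - v) + v (1 - u) with u = q^(k+1) and v = q^(n-k).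
  It fails at k = n, where truncated subtraction makes \<open>qbin q n (Suc n)\<close>
  nonzero.\<close>

lemma qbin_Suc_Suc:
  assumes "norm q < 1" and "k < n"
  shows "qbin q (Suc n) (Suc k) = qbin q n (Suc k) + q ^ (n - k) * qbin q n k"
proof -
  obtain m where n: "n = Suc (k + m)"
    using less_imp_Suc_add[OF assms(2)] by auto
  note nz = qpoch_qq_nonzero[OF assms(1)]
  have nz': "1 - q * q ^ i \<noteq> 0" for i
    using nz[of "Suc i"] by (auto simp: qpoch_Suc)
  have frac: "C * (1 - u * v) / (A * (1 - u) * (B * (1 - v)))
      = C / (A * (1 - u) * B) + v * (C / (A * (B * (1 - v))))"
    if "A \<noteq> 0" "B \<noteq> 0" "1 - u \<noteq> 0" "1 - v \<noteq> 0" for A B C u v :: complex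
  proof -
    have "C * (1 - u * v) = C * (1 - v) + v * C * (1 - u)"
      by (simp add: algebra_simps)
    then have "C * (1 - u * v) / (A * (1 - u) * (B * (1 - v)))
        = C * (1 - v) / (A * (1 - u) * B * (1 - v)) + v * C * (1 - u) / (A * (B * (1 - v)) * (1 - u))"
      by (simp only: add_divide_distrib mult_ac)
    then show ?thesis
      using that by simp
  qed
  show ?thesis
    using frac[OF nz[of k] nz[of m] nz'[of k] nz'[of m], of "qpoch q q n"]
    unfolding qbin_def n
    by (simp add: qpoch_Suc power_add mult_ac)
qed

text \<open>A form of the q-Chu-Vandermonde sum. After the q-Pascal rule the two halves recombine,
  term by term, into the summand for d times 1 - x y q^d.\<close>

lemma qbin_sum:
  assumes q: "norm q < 1"
  shows "(\<Sum>p\<le>d. qbin q d p * x ^ p * qpoch y q p * qpoch x q (d - p)) = qpoch (x * y) q d"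
proof (induction d)
  case 0
  show ?case using qbin_0_and_self[OF q] by simp
next
  case (Suc d)
  define t where "t p = x ^ p * qpoch y q p" for p
  \<comment> \<open>The two halves of the q-Pascal rule; \<open>G\<close> is the half shifted from p
    + 1 down to p. The end terms p = 0 and p = \<open>Suc d\<close>, which
    \<open>qbin_Suc_Suc\<close> does not cover, become \<open>F 0\<close> and
    \<open>G d\<close>.\<close>
  define F where "F p = qbin q d p * t p * qpoch x q (Suc d - p)" for p
  define G where "G p = q ^ (d - p) * qbin q d p * t (Suc p) * qpoch x q (d - p)" for p
  have "(\<Sum>p\<le>Suc d. qbin q (Suc d) p * t p * qpoch x q (Suc d - p))
      = qpoch x q (Suc d) + (\<Sum>p<d. qbin q (Suc d) (Suc p) * t (Suc p) * qpoch x q (d - p))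
        + t (Suc d)"
    using qbin_0_and_self[OF q]
    unfolding sum.atMost_Suc_shift
    by (simp only: lessThan_Suc_atMost[symmetric] sum.lessThan_Suc) (simp add: t_def)
  also have "(\<Sum>p<d. qbin q (Suc d) (Suc p) * t (Suc p) * qpoch x q (d - p))
      = (\<Sum>p<d. F (Suc p)) + (\<Sum>p<d. G p)"
    unfolding sum.distrib[symmetric]
    by (intro sum.cong refl) (simp add: qbin_Suc_Suc[OF q] F_def G_def algebra_simps)
  also have "qpoch x q (Suc d) + ((\<Sum>p<d. F (Suc p)) + (\<Sum>p<d. G p)) + t (Suc d)
      = (\<Sum>p\<le>d. F p) + (\<Sum>p\<le>d. G p)"
  proof -
    have "(\<Sum>p\<le>d. F p) = qpoch x q (Suc d) + (\<Sum>p<d. F (Suc p))"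
      using qbin_0_and_self[OF q] by (subst sum.atMost_shift) (simp add: F_def t_def)
    moreover have "(\<Sum>p\<le>d. G p) = (\<Sum>p<d. G p) + t (Suc d)"
      using qbin_0_and_self[OF q] by (simp add: G_def lessThan_Suc_atMost[symmetric])
    ultimately show ?thesis by simp
  qed
  also have "\<dots> = (\<Sum>p\<le>d. qbin q d p * x ^ p * qpoch y q p * qpoch x q (d - p) * (1 - x * y * q ^ d))"
    unfolding sum.distrib[symmetric]
  \<comment> \<open>Termwise, (1 - x q^(d-p)) + x q^(d-p) (1 - y q^p) = 1 - x y q^d, which is free
    of p.\<close>
  proof (intro sum.cong refl)
    fix p assume "p \<in> {..d}"
    then obtain m where d: "d = p + m" using le_Suc_ex by auto
    show "F p + G p = qbin q d p * x ^ p * qpoch y q p * qpoch x q (d - p) * (1 - x * y * q ^ d)"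
      unfolding F_def G_def t_def d
      by (simp add: Suc_diff_le qpoch_Suc algebra_simps power_add)
  qed
  also have "\<dots> = qpoch (x * y) q (Suc d)"
    unfolding sum_distrib_right[symmetric] Suc by (simp add: qpoch_Suc)
  finally show ?case by (simp add: t_def mult_ac)
qed

section \<open>Bilinear identities for the pairing\<close>

lemma pairing_0 [simp]: "pairing 0 i j = 0"
  by (simp add: pairing_def)

lemma pairing_Suc: "pairing (Suc n) i j = pairing n i j + (\<Sum>a=1..n. i a) * j (Suc n)"
  by (simp add: pairing_def sum_distrib_right atLeastLessThanSuc_atLeastAtMost)

lemma pairing_cong:
  assumes "\<And>a. a \<in> {1..n} \<Longrightarrow> i a = i' a" and "\<And>a. a \<in> {1..n} \<Longrightarrow> j a = j' a"
  shows "pairing n i j = pairing n i' j'"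
  unfolding pairing_def using assms by (intro sum.cong refl arg_cong2[where f="(*)"]) auto

lemma pairing_add_left: "pairing n (\<lambda>a. i a + i' a) j = pairing n i j + pairing n i' j"
  by (simp add: pairing_def sum.distrib algebra_simps)

lemma pairing_add_right: "pairing n i (\<lambda>a. j a + j' a) = pairing n i j + pairing n i j'"
  by (simp add: pairing_def sum.distrib algebra_simps)

lemma pairing_diff_left: "pairing n (\<lambda>a. i a - i' a) j = pairing n i j - pairing n i' j"
  by (simp add: pairing_def sum_subtractf algebra_simps)

lemma pairing_diff_right: "pairing n i (\<lambda>a. j a - j' a) = pairing n i j - pairing n i j'"
  by (simp add: pairing_def sum_subtractf algebra_simps)

text \<open>The double sum over all pairs (a,b), split into a < b, a > b and a = b. It serves to
  bring pairings into one orientation.\<close>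

lemma pairing_swap:
  "pairing n i j + pairing n j i + (\<Sum>a=1..n. i a * j a) = (\<Sum>a=1..n. i a) * (\<Sum>a=1..n. j a)"
  by (induction n) (simp_all add: pairing_Suc algebra_simps)

subsection \<open>A multiple \<open>q\<close>-Vandermonde sum\<close>

text \<open>The box 0 <= m <= d, padded with 0 as in \<open>int_seqs\<close>. The first factor in
  \<open>Acoef\<close> vanishes off the box below j.\<close>

definition lower_seqs :: "nat \<Rightarrow> (nat \<Rightarrow> nat) \<Rightarrow> (nat \<Rightarrow> nat) set" where
  "lower_seqs n d = {m. (\<forall>a. a \<notin> {1..n} \<longrightarrow> m a = 0) \<and> (\<forall>a\<in>{1..n}. m a \<le> d a)}"

lemma lower_seqs_0: "lower_seqs 0 d = {\<lambda>_. 0}"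
  by (auto simp: lower_seqs_def)

lemma lower_seqs_Suc: "lower_seqs (Suc n) d = (\<lambda>(m, p). m(Suc n := p)) ` (lower_seqs n d \<times> {..d (Suc n)})"
proof (intro set_eqI iffI)
  fix m assume m: "m \<in> lower_seqs (Suc n) d"
  then have "(m(Suc n := 0), m (Suc n)) \<in> lower_seqs n d \<times> {..d (Suc n)}"
    by (auto simp: lower_seqs_def)
  moreover have "m = (\<lambda>(m, p). m(Suc n := p)) (m(Suc n := 0), m (Suc n))"
    by simp
  ultimately show "m \<in> (\<lambda>(m, p). m(Suc n := p)) ` (lower_seqs n d \<times> {..d (Suc n)})"
    by (rule rev_image_eqI)
qed (auto simp: lower_seqs_def)

lemma inj_on_lower_seqs_update: "inj_on (\<lambda>(m, p). m(Suc n := p)) (lower_seqs n d \<times> {..d (Suc n)})"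
proof (rule inj_onI; clarify)
  fix m p m' p' assume m: "m \<in> lower_seqs n d" "m' \<in> lower_seqs n d" and e: "m(Suc n := p) = m'(Suc n := p')"
  have "m (Suc n) = 0" "m' (Suc n) = 0" using m by (auto simp: lower_seqs_def)
  then show "m = m' \<and> p = p'"
    using e by (metis fun_upd_idem fun_upd_same fun_upd_upd)
qed

lemma finite_lower_seqs: "finite (lower_seqs n d)"
  by (induction n) (auto simp: lower_seqs_0 lower_seqs_Suc)

lemma sum_lower_seqs_Suc: "(\<Sum>m\<in>lower_seqs (Suc n) d. f m) = (\<Sum>m\<in>lower_seqs n d. \<Sum>p\<le>d (Suc n). f (m(Suc n := p)))"
  unfolding lower_seqs_Suc
  by (subst sum.reindex[OF inj_on_lower_seqs_update]) (simp add: sum.cartesian_product case_prod_unfold)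

lemma sum_lower_seqs_le: "m \<in> lower_seqs n d \<Longrightarrow> (\<Sum>a=1..n. m a) \<le> (\<Sum>a=1..n. d a)"
  by (intro sum_mono) (auto simp: lower_seqs_def)

text \<open>Peeling off the last coordinate leaves an instance of the one-dimensional sum with shifted parameters.\<close>

lemma qbin_lower_seqs_sum:
  assumes q: "norm q < 1" "q \<noteq> 0"
  shows "(\<Sum>m\<in>lower_seqs n d. q powi (pairing n (\<lambda>a. int (d a) - int (m a)) (\<lambda>a. int (m a)))
            * x ^ (\<Sum>a=1..n. m a) * qpoch y q (\<Sum>a=1..n. m a)
            * qpoch x q ((\<Sum>a=1..n. d a) - (\<Sum>a=1..n. m a)) * (\<Prod>a=1..n. qbin q (d a) (m a)))
         = qpoch (x * y) q (\<Sum>a=1..n. d a)"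
proof (induction n)
  case 0
  show ?case by (simp add: lower_seqs_0)
next
  case (Suc n)
  define L where "L = (\<Sum>a=1..n. d a)"
  define e where "e m = pairing n (\<lambda>a. int (d a) - int (m a)) (\<lambda>a. int (m a))" for m
  define s where "s m = (\<Sum>a=1..n. m a)" for m :: "nat \<Rightarrow> nat"
  define w where "w m = q powi e m * x ^ s m * qpoch y q (s m) * qpoch x q (L - s m)
    * (\<Prod>a=1..n. qbin q (d a) (m a))" for m
  have upd: "s (m(Suc n := p)) = s m" "e (m(Suc n := p)) = e m"
      "(\<Prod>a=1..n. qbin q (d a) ((m(Suc n := p)) a)) = (\<Prod>a=1..n. qbin q (d a) (m a))" for m p
    unfolding s_def e_def by (auto intro!: sum.cong prod.cong pairing_cong)
  \<comment> \<open>For fixed m the sum over the last coordinate is \<open>qbin_sum\<close> with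
    parameters x q^r and y q^(s m), where r = L - s m. Their product x y q^L does not depend on
    m.\<close>
  have inner: "(\<Sum>p\<le>d (Suc n). q powi (e m + int (L - s m) * int p) * x ^ (s m + p)
        * qpoch y q (s m + p) * qpoch x q (L + d (Suc n) - (s m + p))
        * ((\<Prod>a=1..n. qbin q (d a) (m a)) * qbin q (d (Suc n)) p))
      = w m * qpoch (x * y * q ^ L) q (d (Suc n))" if m: "m \<in> lower_seqs n d" for m
  proof -
    obtain r where r: "L = s m + r"
      using sum_lower_seqs_le[OF m] unfolding L_def s_def using le_Suc_ex by blast
    have "(\<Sum>p\<le>d (Suc n). q powi (e m + int (L - s m) * int p) * x ^ (s m + p)
        * qpoch y q (s m + p) * qpoch x q (L + d (Suc n) - (s m + p))
        * ((\<Prod>a=1..n. qbin q (d a) (m a)) * qbin q (d (Suc n)) p))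
      = (\<Sum>p\<le>d (Suc n). w m * (qbin q (d (Suc n)) p * (x * q ^ r) ^ p
          * qpoch (y * q ^ s m) q p * qpoch (x * q ^ r) q (d (Suc n) - p)))"
    proof (intro sum.cong refl)
      fix p assume p: "p \<in> {..d (Suc n)}"
      have "L + d (Suc n) - (s m + p) = r + (d (Suc n) - p)"
        using p r by simp
      moreover have "q powi (e m + int (L - s m) * int p) = q powi e m * (q ^ r) ^ p"
        using r q by (simp add: power_int_add power_mult flip: of_nat_mult)
      ultimately show "q powi (e m + int (L - s m) * int p) * x ^ (s m + p)
        * qpoch y q (s m + p) * qpoch x q (L + d (Suc n) - (s m + p))
        * ((\<Prod>a=1..n. qbin q (d a) (m a)) * qbin q (d (Suc n)) p)
        = w m * (qbin q (d (Suc n)) p * (x * q ^ r) ^ p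
          * qpoch (y * q ^ s m) q p * qpoch (x * q ^ r) q (d (Suc n) - p))"
        using r by (simp add: w_def qpoch_add power_add power_mult_distrib mult_ac)
    qed
    also have "\<dots> = w m * qpoch (x * q ^ r * (y * q ^ s m)) q (d (Suc n))"
      by (simp only: sum_distrib_left[symmetric] qbin_sum[OF q(1)])
    finally show ?thesis using r by (simp add: power_add mult_ac)
  qed
  have "(\<Sum>m\<in>lower_seqs (Suc n) d. q powi (pairing (Suc n) (\<lambda>a. int (d a) - int (m a)) (\<lambda>a. int (m a)))
            * x ^ (\<Sum>a=1..Suc n. m a) * qpoch y q (\<Sum>a=1..Suc n. m a)
            * qpoch x q ((\<Sum>a=1..Suc n. d a) - (\<Sum>a=1..Suc n. m a))
            * (\<Prod>a=1..Suc n. qbin q (d a) (m a)))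
     = (\<Sum>m\<in>lower_seqs n d. w m * qpoch (x * y * q ^ L) q (d (Suc n)))"
    unfolding sum_lower_seqs_Suc
  proof (rule sum.cong[OF refl], subst inner[symmetric], assumption, intro sum.cong refl)
    fix m p assume m: "m \<in> lower_seqs n d" and p: "p \<in> {..d (Suc n)}"
    let ?m = "m(Suc n := p)"
    have "pairing (Suc n) (\<lambda>a. int (d a) - int (?m a)) (\<lambda>a. int (?m a)) = e m + int (L - s m) * int p"
    proof -
      have "(\<Sum>a=1..n. int (d a) - int (?m a)) = int L - int (s m)"
        by (simp add: L_def s_def sum_subtractf)
      then show ?thesis
        using upd(2)[of m p] sum_lower_seqs_le[OF m] unfolding pairing_Suc e_def L_def s_def
        by (simp add: of_nat_diff)
    qed
    moreover have "(\<Sum>a=1..Suc n. ?m a) = s m + p"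
      using upd(1)[of m p] unfolding s_def by simp
    moreover have "(\<Prod>a=1..Suc n. qbin q (d a) (?m a)) = (\<Prod>a=1..n. qbin q (d a) (m a)) * qbin q (d (Suc n)) p"
      using upd(3)[of m p] by simp
    moreover have "(\<Sum>a=1..Suc n. d a) = L + d (Suc n)" by (simp add: L_def)
    ultimately show "q powi pairing (Suc n) (\<lambda>a. int (d a) - int (?m a)) (\<lambda>a. int (?m a)) *
           x ^ (\<Sum>a=1..Suc n. ?m a) * qpoch y q (\<Sum>a=1..Suc n. ?m a) *
           qpoch x q ((\<Sum>a=1..Suc n. d a) - (\<Sum>a=1..Suc n. ?m a)) *
           (\<Prod>a=1..Suc n. qbin q (d a) (?m a)) =
        q powi (e m + int (L - s m) * int p) * x ^ (s m + p)
        * qpoch y q (s m + p) * qpoch x q (L + d (Suc n) - (s m + p))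
        * ((\<Prod>a=1..n. qbin q (d a) (m a)) * qbin q (d (Suc n)) p)"
      by simp
  qed
  also have "\<dots> = qpoch (x * y) q L * qpoch (x * y * q ^ L) q (d (Suc n))"
    using Suc unfolding w_def e_def s_def L_def by (simp only: sum_distrib_right[symmetric])
  also have "\<dots> = qpoch (x * y) q (\<Sum>a=1..Suc n. d a)"
    by (simp add: qpoch_add L_def)
  finally show ?case .
qed

subsection \<open>Evaluation of \<open>B\<^sub>1\<close> and \<open>B\<^sub>2\<close>, and orthogonality\<close>

lemma choose_two_add: "(m + n) choose 2 = (m choose 2) + (n choose 2) + m * n"
  by (induction n) (simp_all add: numeral_2_eq_2)

lemma choose_two_sum:
  "(\<Sum>a=1..n. int (i a choose 2)) + pairing n (\<lambda>a. int (i a)) (\<lambda>a. int (i a))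
    = int ((\<Sum>a=1..n. i a) choose 2)"
  by (induction n) (simp_all add: pairing_Suc choose_two_add)

text \<open>For j > k the factor 1 - q^(-k) q^k is 0, which makes the matrix of values of B2
  triangular. For j <= k this is \<open>qpoch_reflect\<close> with y = q^(k-j+1).\<close>

lemma qpoch_neg_power:
  assumes q: "norm q < 1" "q \<noteq> 0"
  shows "qpoch (q powi (- int k)) q j =
    (if j \<le> k then (- 1) ^ j * (q powi int (j choose 2) * q powi (- (int k * int j)))
       * (qpoch q q k / qpoch q q (k - j)) else 0)"
proof (cases "j \<le> k")
  case True
  have "q powi (- int k) * (q * q ^ (k - j)) * q ^ j = q"
    using True q by (simp add: power_int_minus power_add[symmetric] field_simps)
  then have "qpoch (q powi (- int k)) q j
      = (- (q powi (- int k))) ^ j * q ^ (j choose 2) * qpoch (q * q ^ (k - j)) q j"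
    using q by (intro qpoch_reflect)
  also have "qpoch (q * q ^ (k - j)) q j = qpoch q q k / qpoch q q (k - j)"
    using qpoch_add[of q q "k - j" j] True qpoch_qq_nonzero[OF q(1)] by (simp add: field_simps)
  also have "(- (q powi (- int k))) ^ j * q ^ (j choose 2)
      = (- 1) ^ j * (q powi int (j choose 2) * q powi (- (int k * int j)))"
    using q by (subst power_minus, simp add: power_int_minus power_mult
        field_simps flip: of_nat_mult) (metis mult.commute power_mult)
  finally show ?thesis using True by simp
next
  case False
  then have "\<exists>t\<in>{..<j}. 1 - q powi (- int k) * q ^ t = 0"
    using q by (intro bexI[of _ k]) (auto simp: power_int_minus)
  then show ?thesis using False by (simp add: qpoch_def)
qed

text \<open>Normalised by z_1 = 1, with ratios z_(a+1)/z_a = q^(k_a), so that the Pochhammer symbols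
  in B2 get the terminating arguments q^(-k_a).\<close>

definition zpt :: "complex \<Rightarrow> (nat \<Rightarrow> nat) \<Rightarrow> nat \<Rightarrow> complex" where
  "zpt q k a = q ^ (\<Sum>b=1..<a. k b)"

lemma zpt_1 [simp]: "zpt q k (Suc 0) = 1"
  by (simp add: zpt_def)

lemma zpt_Suc: "a \<ge> 1 \<Longrightarrow> zpt q k (Suc a) = q ^ k a * zpt q k a"
  by (simp add: zpt_def power_add)

lemma zpt_last: "zpt q k (Suc n) = q ^ (\<Sum>a=1..n. k a)"
  by (simp add: zpt_def atLeastLessThanSuc_atLeastAtMost)

lemma zpt_nonzero: "q \<noteq> 0 \<Longrightarrow> zpt q k a \<noteq> 0"
  by (simp add: zpt_def)

lemma prod_zpt:
  assumes "q \<noteq> 0"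
  shows "(\<Prod>a=1..n. zpt q k a ^ i a) = q powi pairing n (\<lambda>a. int (k a)) (\<lambda>a. int (i a))"
proof (induction n)
  case (Suc n)
  have "q powi (int (\<Sum>a=1..n. k a) * int (i (Suc n))) = zpt q k (Suc n) ^ i (Suc n)"
    unfolding zpt_last by (simp only: of_nat_mult[symmetric] power_int_of_nat power_mult)
  then show ?case
    using Suc assms by (simp add: pairing_Suc power_int_add)
qed simp

lemma prod_zpt_Suc:
  assumes "q \<noteq> 0"
  shows "(\<Prod>a=1..n. zpt q k (Suc a) ^ i a)
    = q powi (pairing n (\<lambda>a. int (k a)) (\<lambda>a. int (i a)) + (\<Sum>a=1..n. int (k a) * int (i a)))"
proof -
  have "(\<Prod>a=1..n. zpt q k (Suc a) ^ i a)
      = (\<Prod>a=1..n. q powi (int (k a) * int (i a))) * (\<Prod>a=1..n. zpt q k a ^ i a)"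
    unfolding prod.distrib[symmetric]
    by (intro prod.cong refl)
       (simp add: zpt_Suc power_mult_distrib power_mult flip: of_nat_mult)
  also have "(\<Prod>a=1..n. q powi (int (k a) * int (i a))) = q powi (\<Sum>a=1..n. int (k a) * int (i a))"
    using assms by (induction n) (auto simp: power_int_add)
  finally show ?thesis
    by (simp only: prod_zpt[OF assms] power_int_add[OF disjI1[OF assms]] mult.commute)
qed

text \<open>Here N = \<open>Suc n\<close>. The wrap-around ratio z_(N+1)/z_N is \<Lambda>/q^|k|,
  because z_1 = 1 and z_N = q^|k|; hence the separate last factor.\<close>

lemma B1_zpt:
  assumes q: "q \<noteq> 0"
  shows "B1 q (Suc n) \<mu> i (zpt q k) \<Lambda> =
    (\<Prod>a=1..n. qpoch (\<mu> a * q ^ k a) q (i a))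
    * qpoch (\<mu> (Suc n) * (\<Lambda> / q ^ (\<Sum>a=1..n. k a))) q (i (Suc n))
    * q powi pairing (Suc n) (\<lambda>a. int (k a)) (\<lambda>a. int (i a))"
proof -
  have "B1 q (Suc n) \<mu> i (zpt q k) \<Lambda> =
    (\<Prod>a=1..Suc n. qpoch (\<mu> a * (zext (Suc n) \<Lambda> (zpt q k) (a + 1) / zext (Suc n) \<Lambda> (zpt q k) a)) q (i a))
     * (\<Prod>a=1..Suc n. zpt q k a ^ i a)"
    unfolding B1_def prod.distrib[symmetric] by (intro prod.cong refl) (auto simp: zext_def)
  also have "(\<Prod>a=1..Suc n. qpoch (\<mu> a * (zext (Suc n) \<Lambda> (zpt q k) (a + 1) / zext (Suc n) \<Lambda> (zpt q k) a)) q (i a))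
     = (\<Prod>a=1..n. qpoch (\<mu> a * (zext (Suc n) \<Lambda> (zpt q k) (a + 1) / zext (Suc n) \<Lambda> (zpt q k) a)) q (i a))
      * qpoch (\<mu> (Suc n) * (\<Lambda> / q ^ (\<Sum>a=1..n. k a))) q (i (Suc n))"
    by (simp add: zext_def zpt_last)
  also have "(\<Prod>a=1..n. qpoch (\<mu> a * (zext (Suc n) \<Lambda> (zpt q k) (a + 1) / zext (Suc n) \<Lambda> (zpt q k) a)) q (i a))
      = (\<Prod>a=1..n. qpoch (\<mu> a * q ^ k a) q (i a))"
    by (intro prod.cong refl) (auto simp: zext_def zpt_Suc zpt_nonzero[OF q])
  finally show ?thesis
    by (simp only: prod_zpt[OF q])
qed

text \<open>The ratios are the reciprocals of those in B1. The sum of the k_a i_a in the exponent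
  arises because B2 carries powers of z_(a+1) instead of z_a.\<close>

lemma B2_zpt:
  assumes q: "q \<noteq> 0"
  shows "B2 q (Suc n) i (zpt q k) \<Lambda> =
    (\<Prod>a=1..n. qpoch (q powi (- int (k a))) q (i a))
    * q powi (pairing n (\<lambda>a. int (k a)) (\<lambda>a. int (i a)) + (\<Sum>a=1..n. int (k a) * int (i a)))
    * qpoch (1 / \<Lambda> * q ^ (\<Sum>a=1..n. k a)) q (i (Suc n)) * \<Lambda> ^ i (Suc n)"
proof -
  have "B2 q (Suc n) i (zpt q k) \<Lambda> =
    (\<Prod>a=1..n. qpoch (zext (Suc n) \<Lambda> (zpt q k) a / zext (Suc n) \<Lambda> (zpt q k) (a + 1)) q (i a)
       * zext (Suc n) \<Lambda> (zpt q k) (a + 1) ^ i a)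
     * (qpoch (1 / \<Lambda> * q ^ (\<Sum>a=1..n. k a)) q (i (Suc n)) * \<Lambda> ^ i (Suc n))"
    unfolding B2_def by (simp add: zext_def zpt_last)
  also have "(\<Prod>a=1..n. qpoch (zext (Suc n) \<Lambda> (zpt q k) a / zext (Suc n) \<Lambda> (zpt q k) (a + 1)) q (i a)
       * zext (Suc n) \<Lambda> (zpt q k) (a + 1) ^ i a)
     = (\<Prod>a=1..n. qpoch (q powi (- int (k a))) q (i a)) * (\<Prod>a=1..n. zpt q k (Suc a) ^ i a)"
    unfolding prod.distrib[symmetric]
  proof (intro prod.cong refl)
    fix a assume a: "a \<in> {1..n}"
    then have "zpt q k a / zpt q k (Suc a) = q powi (- int (k a))"
      using zpt_nonzero[OF q] q by (simp add: zpt_Suc power_int_minus field_simps)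
    then show "qpoch (zext (Suc n) \<Lambda> (zpt q k) a / zext (Suc n) \<Lambda> (zpt q k) (a + 1)) q (i a)
       * zext (Suc n) \<Lambda> (zpt q k) (a + 1) ^ i a
       = qpoch (q powi (- int (k a))) q (i a) * zpt q k (Suc a) ^ i a"
      using a by (simp add: zext_def)
  qed
  finally show ?thesis
    by (simp only: prod_zpt_Suc[OF q] mult.assoc)
qed

lemma Phi_of_nat:
  assumes "\<And>a. a \<in> {1..n} \<Longrightarrow> k a \<le> j a"
  shows "Phi q n (\<lambda>a. int (k a)) (\<lambda>a. int (j a)) y \<mu> =
    q powi pairing n (\<lambda>a. int (j a) - int (k a)) (\<lambda>a. int (k a)) * (\<mu> / y) ^ (\<Sum>a=1..n. k a)
    * (qpoch y q (\<Sum>a=1..n. k a) * qpoch (\<mu> / y) q ((\<Sum>a=1..n. j a) - (\<Sum>a=1..n. k a))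
       / qpoch \<mu> q (\<Sum>a=1..n. j a))
    * (\<Prod>a=1..n. qbin q (j a) (k a))"
proof -
  have 1: "(\<Sum>a=1..n. int (k a)) = int (\<Sum>a=1..n. k a)" "(\<Sum>a=1..n. int (j a)) = int (\<Sum>a=1..n. j a)"
    by simp_all
  have "(\<Prod>a=1..n. qpoch q q (nat (int (j a)))
            / (qpoch q q (nat (int (k a))) * qpoch q q (nat (int (j a) - int (k a)))))
      = (\<Prod>a=1..n. qbin q (j a) (k a))"
    by (simp add: qbin_def nat_minus_as_int)
  moreover have "nat (int (\<Sum>a=1..n. j a) - int (\<Sum>a=1..n. k a)) = (\<Sum>a=1..n. j a) - (\<Sum>a=1..n. k a)"
    by (simp only: nat_diff_distrib of_nat_0_le_iff nat_int)
  ultimately show ?thesis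
    using assms unfolding Phi_def 1 by (simp only: nat_int power_int_of_nat) auto
qed

lemma index_setD: "i \<in> index_set (Suc n) M \<Longrightarrow> (\<Sum>a=1..n. i a) + i (Suc n) = M"
  by (simp add: index_set_def)

text \<open>The last entry is fixed by the total M.\<close>

lemma index_set_eqI:
  assumes "i \<in> index_set (Suc n) M" "j \<in> index_set (Suc n) M" and "\<And>a. a \<in> {1..n} \<Longrightarrow> i a = j a"
  shows "i = j"
proof
  fix a
  have "(\<Sum>a=1..n. i a) = (\<Sum>a=1..n. j a)"
    using assms(3) by (rule sum.cong[OF refl])
  then have "i (Suc n) = j (Suc n)"
    using assms(1,2)[THEN index_setD] by linarith
  moreover have "i a = j a" if "a \<notin> {1..Suc n}"
    using assms that unfolding index_set_def by force
  ultimately show "i a = j a"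
    using assms(3)[of a] by (metis atLeastAtMost_iff le_Suc_eq)
qed

text \<open>Only k with i <= k <= j contribute. Substituting k = i + m and d = j - i on the first n
  entries gives a multiple of \<open>qbin_lower_seqs_sum\<close> with x y = 1, whose value (1;q)_|d|
  is 0 unless d = 0.\<close>

lemma sum_Phi_B2_zpt:
  assumes q: "norm q < 1" "q \<noteq> 0" and \<Lambda>: "\<Lambda> \<noteq> 0"
    and i: "i \<in> index_set (Suc n) M" and j: "j \<in> index_set (Suc n) M"
  shows "(\<Sum>k\<in>lower_seqs n j. Phi q n (\<lambda>a. int (k a)) (\<lambda>a. int (j a)) (1 / \<Lambda>) (q powi (- int M))
            * B2 q (Suc n) i (zpt q k) \<Lambda>)
    = (if i = j then \<Lambda> ^ M * qpoch (1 / \<Lambda>) q M * (\<Prod>a=1..Suc n. qpoch q q (j a)) / qpoch q q M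
       else 0)"
    (is "(\<Sum>k\<in>_. ?f k) = ?rhs")
proof -
  have vanish: "?f k = 0" if a: "a \<in> {1..n}" "k a < i a" for k a
  proof -
    have "\<exists>a\<in>{1..n}. qpoch (q powi (- int (k a))) q (i a) = 0"
      using a by (intro bexI[of _ a]) (simp_all add: qpoch_neg_power[OF q])
    then have "(\<Prod>a=1..n. qpoch (q powi (- int (k a))) q (i a)) = 0"
      by (intro prod_zero) auto
    then show ?thesis by (simp add: B2_zpt[OF q(2)])
  qed
  show ?thesis
  proof (cases "\<forall>a\<in>{1..n}. i a \<le> j a")
    case False
    then obtain a where a: "a \<in> {1..n}" "j a < i a" by auto
    have "?f k = 0" if "k \<in> lower_seqs n j" for k
      using that a by (intro vanish[of a]) (auto simp: lower_seqs_def intro: le_less_trans)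
    then have "(\<Sum>k\<in>lower_seqs n j. ?f k) = 0"
      by (intro sum.neutral ballI)
    then show ?thesis using a by auto
  next
    case True
    define d where "d a = j a - i a" for a
    define s where "s m = (\<Sum>a=1..n. m a)" for m :: "nat \<Rightarrow> nat"
    define \<phi> where "\<phi> m a = (if a \<in> {1..n} then i a + m a else 0)" for m a
    \<comment> \<open>x is the quotient of the two parameters of \<open>Phi\<close>, and y continues
      (1/\<Lambda>;q)_M: (1/\<Lambda>;q)_(M+p) = (1/\<Lambda>;q)_M (y;q)_p. \<open>K\<close> below
      collects the factors free of m.\<close>
    define x where "x = q powi (- int M) * \<Lambda>"
    define y where "y = 1 / \<Lambda> * q ^ M"
    define K where "K = (\<Prod>a=1..n. (- 1) ^ i a * q powi int (i a choose 2) * (qpoch q q (j a) / qpoch q q (d a)))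
      * \<Lambda> ^ i (Suc n) / qpoch (q powi (- int M)) q (s j)
      * q powi pairing n (\<lambda>a. int (j a)) (\<lambda>a. int (i a)) * x ^ s i * qpoch (1 / \<Lambda>) q M"
    have j_eq: "j a = i a + d a" if "a \<in> {1..n}" for a
      using True that by (simp add: d_def)
    have sj: "s j = s i + s d"
      unfolding s_def by (simp add: j_eq sum.distrib)
    have xy: "x * y = 1"
      using q \<Lambda> by (simp add: x_def y_def power_int_minus)
    have term_eq: "?f (\<phi> m) = K * (q powi (pairing n (\<lambda>a. int (d a) - int (m a)) (\<lambda>a. int (m a)))
            * x ^ s m * qpoch y q (s m) * qpoch x q (s d - s m) * (\<Prod>a=1..n. qbin q (d a) (m a)))"
      if m: "m \<in> lower_seqs n d" for m
    proof -
      have md: "m a \<le> d a" if "a \<in> {1..n}" for a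
        using m that by (auto simp: lower_seqs_def)
      have s\<phi>: "s (\<phi> m) = s i + s m"
        unfolding s_def \<phi>_def by (simp add: sum.distrib)
      \<comment> \<open>In each coordinate (q;q)_(i+m) cancels and the binomial of d over m remains;
        apart from a power of q, all else is free of m.\<close>
      have "(\<Prod>a=1..n. qbin q (j a) (\<phi> m a)) * (\<Prod>a=1..n. qpoch (q powi (- int (\<phi> m a))) q (i a))
        = (\<Prod>a=1..n. ((- 1) ^ i a * q powi int (i a choose 2) * (qpoch q q (j a) / qpoch q q (d a)))
             * (q powi (- (int (\<phi> m a) * int (i a))) * qbin q (d a) (m a)))"
        unfolding prod.distrib[symmetric]
      proof (intro prod.cong refl)
        fix a assume a: "a \<in> {1..n}"
        have "qbin q (j a) (\<phi> m a) * (qpoch q q (\<phi> m a) / qpoch q q (m a))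
            = qpoch q q (j a) / qpoch q q (d a) * qbin q (d a) (m a)"
          using a j_eq[OF a] qpoch_qq_nonzero[OF q(1)] by (simp add: qbin_def \<phi>_def)
        then have R: "C * (qbin q (j a) (\<phi> m a) * (qpoch q q (\<phi> m a) / qpoch q q (m a)))
            = C * (qpoch q q (j a) / qpoch q q (d a) * qbin q (d a) (m a))" for C
          by (rule arg_cong)
        have "qpoch (q powi (- int (\<phi> m a))) q (i a) = (- 1) ^ i a
            * (q powi int (i a choose 2) * q powi (- (int (\<phi> m a) * int (i a))))
            * (qpoch q q (\<phi> m a) / qpoch q q (m a))"
        proof -
          have "i a \<le> \<phi> m a" "\<phi> m a - i a = m a"
            using a by (auto simp: \<phi>_def)
          then show ?thesis
            by (simp only: qpoch_neg_power[OF q] if_True)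
        qed
        then show "qbin q (j a) (\<phi> m a) * qpoch (q powi (- int (\<phi> m a))) q (i a) =
           ((- 1) ^ i a * q powi int (i a choose 2) * (qpoch q q (j a) / qpoch q q (d a)))
             * (q powi (- (int (\<phi> m a) * int (i a))) * qbin q (d a) (m a))"
          using R[of "(- 1) ^ i a * q powi int (i a choose 2) * q powi (- (int (\<phi> m a) * int (i a)))"]
          by (simp only: mult_ac)
      qed
      also have "\<dots> = (\<Prod>a=1..n. (- 1) ^ i a * q powi int (i a choose 2) * (qpoch q q (j a) / qpoch q q (d a)))
          * (q powi (- (\<Sum>a=1..n. int (\<phi> m a) * int (i a))) * (\<Prod>a=1..n. qbin q (d a) (m a)))"
      proof -
        have "(\<Prod>a=1..n. q powi (- (int (\<phi> m a) * int (i a))))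
            = q powi (- (\<Sum>a=1..n. int (\<phi> m a) * int (i a)))" for n
          using q by (induction n) (auto simp: power_int_diff power_int_minus field_simps)
        then show ?thesis by (simp only: prod.distrib)
      qed
      finally have P: "(\<Prod>a=1..n. qbin q (j a) (\<phi> m a)) * (\<Prod>a=1..n. qpoch (q powi (- int (\<phi> m a))) q (i a))
        = (\<Prod>a=1..n. (- 1) ^ i a * q powi int (i a choose 2) * (qpoch q q (j a) / qpoch q q (d a)))
          * (q powi (- (\<Sum>a=1..n. int (\<phi> m a) * int (i a))) * (\<Prod>a=1..n. qbin q (d a) (m a)))" .
      \<comment> \<open>The diagonal terms cancel those coming from \<open>qpoch_neg_power\<close>,
        and the pairings of m with i cancel too. The exponent thus splits into that of the
        Vandermonde sum and a part free of m.\<close>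
      have "pairing n (\<lambda>a. int (j a) - int (\<phi> m a)) (\<lambda>a. int (\<phi> m a))
          + (pairing n (\<lambda>a. int (\<phi> m a)) (\<lambda>a. int (i a)) + (\<Sum>a=1..n. int (\<phi> m a) * int (i a)))
          - (\<Sum>a=1..n. int (\<phi> m a) * int (i a))
        = pairing n (\<lambda>a. int (d a) - int (m a)) (\<lambda>a. int (i a) + int (m a))
          + pairing n (\<lambda>a. int (i a) + int (m a)) (\<lambda>a. int (i a))"
        by (simp, intro arg_cong2[where f="(+)"] pairing_cong) (auto simp: \<phi>_def j_eq)
      also have "\<dots> = pairing n (\<lambda>a. int (d a) - int (m a)) (\<lambda>a. int (m a))
          + pairing n (\<lambda>a. int (i a) + int (d a)) (\<lambda>a. int (i a))"
        by (simp only: pairing_add_left pairing_add_right pairing_diff_left)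
      also have "pairing n (\<lambda>a. int (i a) + int (d a)) (\<lambda>a. int (i a)) = pairing n (\<lambda>a. int (j a)) (\<lambda>a. int (i a))"
        by (intro pairing_cong) (auto simp: j_eq)
      finally have E: "q powi pairing n (\<lambda>a. int (j a) - int (\<phi> m a)) (\<lambda>a. int (\<phi> m a))
          * q powi (pairing n (\<lambda>a. int (\<phi> m a)) (\<lambda>a. int (i a)) + (\<Sum>a=1..n. int (\<phi> m a) * int (i a)))
          * q powi (- (\<Sum>a=1..n. int (\<phi> m a) * int (i a)))
        = q powi pairing n (\<lambda>a. int (d a) - int (m a)) (\<lambda>a. int (m a))
          * q powi pairing n (\<lambda>a. int (j a)) (\<lambda>a. int (i a))"
        using q by (simp add: power_int_add[symmetric])
      \<comment> \<open>Since i has total M, the two Pochhammer symbols in 1/\<Lambda> join into one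
        of length M + |m|.\<close>
      have "s i + s m + i (Suc n) = M + s m"
        using index_setD[OF i] by (simp add: s_def)
      then have Q: "qpoch (1 / \<Lambda>) q (s (\<phi> m)) * qpoch (1 / \<Lambda> * q ^ s (\<phi> m)) q (i (Suc n))
          = qpoch (1 / \<Lambda>) q M * qpoch y q (s m)"
        unfolding s\<phi> y_def by (simp only: qpoch_add[symmetric])
      have "?f (\<phi> m) = (q powi pairing n (\<lambda>a. int (j a) - int (\<phi> m a)) (\<lambda>a. int (\<phi> m a)) * x ^ s (\<phi> m)
          * (qpoch (1 / \<Lambda>) q (s (\<phi> m)) * qpoch x q (s j - s (\<phi> m)) / qpoch (q powi (- int M)) q (s j))
          * (\<Prod>a=1..n. qbin q (j a) (\<phi> m a)))
        * ((\<Prod>a=1..n. qpoch (q powi (- int (\<phi> m a))) q (i a))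
          * q powi (pairing n (\<lambda>a. int (\<phi> m a)) (\<lambda>a. int (i a)) + (\<Sum>a=1..n. int (\<phi> m a) * int (i a)))
          * qpoch (1 / \<Lambda> * q ^ s (\<phi> m)) q (i (Suc n)) * \<Lambda> ^ i (Suc n))"
        unfolding B2_zpt[OF q(2)] s_def x_def
        by (subst Phi_of_nat) (auto simp: \<phi>_def j_eq md)
      also have "\<dots> = (q powi pairing n (\<lambda>a. int (j a) - int (\<phi> m a)) (\<lambda>a. int (\<phi> m a))
          * q powi (pairing n (\<lambda>a. int (\<phi> m a)) (\<lambda>a. int (i a)) + (\<Sum>a=1..n. int (\<phi> m a) * int (i a))))
        * ((\<Prod>a=1..n. qbin q (j a) (\<phi> m a)) * (\<Prod>a=1..n. qpoch (q powi (- int (\<phi> m a))) q (i a)))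
        * (qpoch (1 / \<Lambda>) q (s (\<phi> m)) * qpoch (1 / \<Lambda> * q ^ s (\<phi> m)) q (i (Suc n)))
        * (x ^ s (\<phi> m) * qpoch x q (s j - s (\<phi> m)) / qpoch (q powi (- int M)) q (s j) * \<Lambda> ^ i (Suc n))"
        by simp
      also have "\<dots> = (q powi pairing n (\<lambda>a. int (j a) - int (\<phi> m a)) (\<lambda>a. int (\<phi> m a))
          * q powi (pairing n (\<lambda>a. int (\<phi> m a)) (\<lambda>a. int (i a)) + (\<Sum>a=1..n. int (\<phi> m a) * int (i a)))
          * q powi (- (\<Sum>a=1..n. int (\<phi> m a) * int (i a))))
        * (\<Prod>a=1..n. (- 1) ^ i a * q powi int (i a choose 2) * (qpoch q q (j a) / qpoch q q (d a)))
        * (\<Prod>a=1..n. qbin q (d a) (m a))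
        * (qpoch (1 / \<Lambda>) q M * qpoch y q (s m))
        * (x ^ s i * x ^ s m * qpoch x q (s d - s m) / qpoch (q powi (- int M)) q (s j) * \<Lambda> ^ i (Suc n))"
        unfolding P Q by (simp only: s\<phi> sj power_add mult_ac add_diff_cancel_left)
      also have "\<dots> = K * (q powi (pairing n (\<lambda>a. int (d a) - int (m a)) (\<lambda>a. int (m a)))
            * x ^ s m * qpoch y q (s m) * qpoch x q (s d - s m) * (\<Prod>a=1..n. qbin q (d a) (m a)))"
        unfolding E K_def by simp
      finally show ?thesis .
    qed
    have inj: "inj_on \<phi> (lower_seqs n d)"
    proof (rule inj_onI, rule ext)
      fix m m' a assume m: "m \<in> lower_seqs n d" "m' \<in> lower_seqs n d" and e: "\<phi> m = \<phi> m'"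
      show "m a = m' a"
        using m fun_cong[OF e, of a] by (cases "a \<in> {1..n}") (auto simp: \<phi>_def lower_seqs_def)
    qed
    \<comment> \<open>The k >= i in the box below j are exactly the i + m with m in the box below
      d.\<close>
    have "(\<Sum>k\<in>lower_seqs n j. ?f k) = (\<Sum>k\<in>\<phi> ` lower_seqs n d. ?f k)"
    proof (intro sum.mono_neutral_right ballI finite_lower_seqs)
      show "\<phi> ` lower_seqs n d \<subseteq> lower_seqs n j"
        by (auto simp: lower_seqs_def \<phi>_def j_eq)
      fix k assume k: "k \<in> lower_seqs n j - \<phi> ` lower_seqs n d"
      have "\<exists>a\<in>{1..n}. k a < i a"
      proof (rule ccontr)
        assume "\<not> (\<exists>a\<in>{1..n}. k a < i a)"
        then have ki: "i a \<le> k a" if "a \<in> {1..n}" for a using that by (auto simp: not_less)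
        define m where "m a = (if a \<in> {1..n} then k a - i a else 0)" for a
        have "k = \<phi> m"
          using k ki by (auto simp: fun_eq_iff \<phi>_def m_def lower_seqs_def)
        moreover have "m \<in> lower_seqs n d"
          using k by (auto simp: m_def lower_seqs_def d_def intro: diff_le_mono)
        ultimately show False using k by blast
      qed
      then show "?f k = 0" using vanish by blast
    qed
    also have "\<dots> = (\<Sum>m\<in>lower_seqs n d. K * (q powi (pairing n (\<lambda>a. int (d a) - int (m a)) (\<lambda>a. int (m a)))
            * x ^ s m * qpoch y q (s m) * qpoch x q (s d - s m) * (\<Prod>a=1..n. qbin q (d a) (m a))))"
      by (simp only: sum.reindex[OF inj] o_def term_eq cong: sum.cong)
    also have "\<dots> = K * qpoch (x * y) q (s d)"
      using qbin_lower_seqs_sum[OF q, of n d x y] unfolding s_def by (simp only: sum_distrib_left[symmetric])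
    also have "\<dots> = ?rhs"
    proof (cases "i = j")
      case False
      then obtain a where "a \<in> {1..n}" "i a \<noteq> j a"
        using index_set_eqI[OF i j] by blast
      \<comment> \<open>A positive length puts the factor 1 - 1 into (1;q)_|d|.\<close>
      then have "s d \<noteq> 0"
        using j_eq[of a] by (auto simp: s_def)
      then have "qpoch 1 q (s d) = 0"
        unfolding qpoch_def by (intro prod_zero bexI[of _ 0]) auto
      then show ?thesis
        using False unfolding xy by simp
    next
      case True
      have d: "d = (\<lambda>_. 0)" by (simp add: fun_eq_iff d_def True)
      have sM: "s j \<le> M" "M - s j = j (Suc n)"
        using index_setD[OF j] by (auto simp: s_def)
      have e: "(\<Prod>a=1..n. (- 1) ^ j a * q powi int (j a choose 2) * (qpoch q q (j a) / qpoch q q (d a)))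
        = (- 1) ^ s j * q powi (\<Sum>a=1..n. int (j a choose 2)) * (\<Prod>a=1..n. qpoch q q (j a))"
      proof -
        have "(\<Prod>a=1..n. q powi int (j a choose 2)) = q powi (\<Sum>a=1..n. int (j a choose 2))" for n
          using q by (induction n) (auto simp: power_int_add)
        moreover have "(\<Prod>a=1..n. (- 1) ^ j a) = (- 1 :: complex) ^ s j"
          by (simp add: s_def power_sum)
        ultimately show ?thesis
          by (simp only: prod.distrib d qpoch_0 div_by_1)
      qed
      have "K = (- 1) ^ s j * (q powi (\<Sum>a=1..n. int (j a choose 2))
           * q powi pairing n (\<lambda>a. int (j a)) (\<lambda>a. int (j a))) * (\<Prod>a=1..n. qpoch q q (j a))
         * \<Lambda> ^ j (Suc n) / qpoch (q powi (- int M)) q (s j) * x ^ s j * qpoch (1 / \<Lambda>) q M"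
        unfolding K_def True e by (simp only: mult_ac times_divide_eq_right)
      also have "q powi (\<Sum>a=1..n. int (j a choose 2)) * q powi pairing n (\<lambda>a. int (j a)) (\<lambda>a. int (j a))
          = q powi int (s j choose 2)"
        unfolding s_def choose_two_sum[symmetric] using q by (simp add: power_int_add)
      \<comment> \<open>The sign and the powers of q produced here cancel the sign and the power in
        the numerator together with the power of q in x^(s j).\<close>
      also have "qpoch (q powi (- int M)) q (s j) = (- 1) ^ s j * q powi int (s j choose 2)
          * (q powi (- (int M * int (s j)))) * (qpoch q q M / qpoch q q (j (Suc n)))"
        using sM by (simp only: qpoch_neg_power[OF q] if_True mult.assoc)
      also have "x ^ s j = q powi (- (int M * int (s j))) * \<Lambda> ^ s j"
        by (simp add: x_def power_mult_distrib power_int_mult flip: mult_minus_left)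
      also have "(- 1) ^ s j * q powi int (s j choose 2) * (\<Prod>a=1..n. qpoch q q (j a)) * \<Lambda> ^ j (Suc n)
          / ((- 1) ^ s j * q powi int (s j choose 2) * (q powi (- (int M * int (s j)))) * (qpoch q q M / qpoch q q (j (Suc n))))
          * (q powi (- (int M * int (s j))) * \<Lambda> ^ s j) * qpoch (1 / \<Lambda>) q M
         = (\<Lambda> ^ s j * \<Lambda> ^ j (Suc n)) * qpoch (1 / \<Lambda>) q M * (\<Prod>a=1..Suc n. qpoch q q (j a)) / qpoch q q M"
        using q by simp
      also have "\<Lambda> ^ s j * \<Lambda> ^ j (Suc n) = \<Lambda> ^ M"
        using index_setD[OF j] by (simp add: s_def power_add[symmetric])
      finally show ?thesis
        using True by (simp add: d s_def)
    qed
    finally show ?thesis .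
  qed
qed

subsection \<open>The coefficients as sums over evaluation points\<close>

lemma qpow_add: "qpow l (x + y) = qpow l x * qpow l y"
  by (simp add: qpow_def exp_add algebra_simps)

lemma qpow_nonzero [simp]: "qpow l x \<noteq> 0"
  by (simp add: qpow_def)

lemma qpow_0 [simp]: "qpow l 0 = 1"
  by (simp add: qpow_def)

lemma qpow_minus: "qpow l (- x) = inverse (qpow l x)"
  by (simp add: qpow_def exp_minus)

lemma qpow_diff: "qpow l (x - y) = qpow l x / qpow l y"
  by (simp add: qpow_def exp_diff algebra_simps)

lemma qpow_sum: "qpow l (\<Sum>a\<in>A. f a) = (\<Prod>a\<in>A. qpow l (f a))"
  by (induction A rule: infinite_finite_induct) (auto simp: qpow_add)

lemma qpow_mult_of_nat: "qpow l (x * of_nat n) = qpow l x ^ n"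
  by (simp add: qpow_def exp_of_nat_mult[symmetric] algebra_simps)

lemma qpow_of_nat: "qpow l (of_nat n) = exp l ^ n"
  by (simp add: qpow_def exp_of_nat_mult)

lemma qpow_of_int: "qpow l (of_int n) = exp l powi n"
  by (cases n rule: int_cases2) (simp_all add: qpow_of_nat qpow_minus power_int_minus)

lemma of_int_pairing:
  "of_int (pairing n i j) = (pairing n (\<lambda>a. of_int (i a)) (\<lambda>a. of_int (j a)) :: complex)"
  by (simp add: pairing_def)

lemma of_nat_choose_two: "of_nat (n choose 2) = (of_nat n * of_nat n - of_nat n :: complex) / 2"
  by (induction n) (simp_all add: numeral_2_eq_2 field_simps)

text \<open>The last product is the value in \<open>B1_zpt\<close> without its power of q. Each
  (q^(\<gamma>_a+1);q)_(i_a) is reflected; the denominator of length D cancels the first D factors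
  of the numerator of length M, and the remaining ones form the wrap-around factor.\<close>

lemma Phi_cont_eq:
  fixes l \<Lambda> :: complex and n M :: nat and i k :: "nat \<Rightarrow> nat" and c :: "nat \<Rightarrow> complex"
  defines "q \<equiv> exp l"
  defines "D \<equiv> (\<Sum>a=1..n. i a)"
  defines "\<gamma> \<equiv> (\<lambda>a. c a - of_nat (i a) - of_nat (k a))"
  defines "\<nu> \<equiv> \<Lambda> * qpow l (- (\<Sum>a=1..Suc n. c a))"
  assumes q: "norm q < 1" and i: "i \<in> index_set (Suc n) M"
    and nz: "qpoch (\<nu> * qpow l (\<Sum>a=1..n. \<gamma> a)) q D \<noteq> 0"
  shows "Phi_cont q l n M \<gamma> (\<lambda>a. c a - of_nat (k a)) \<nu>
    = qpow l (pairing n (\<lambda>a. of_nat (i a)) \<gamma> - of_nat M * (\<Sum>a=1..n. \<gamma> a)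
        + of_nat (D choose 2) - of_nat M * of_nat D
        + (\<Sum>a=1..n. of_nat (i a choose 2) + (\<gamma> a + 1) * of_nat (i a)))
      * qpoch q q M / ((\<Prod>a=1..Suc n. qpoch q q (i a)) * qpoch \<nu> q M)
      * ((\<Prod>a=1..n. qpoch (qpow l (- c a) * q ^ k a) q (i a))
         * qpoch (qpow l (- c (Suc n)) * (\<Lambda> / q ^ (\<Sum>a=1..n. k a))) q (i (Suc n)))"
proof -
  define G where "G = (\<Sum>a=1..n. \<gamma> a)"
  have q0: "q \<noteq> 0" by (simp add: q_def)
  have M: "M = D + i (Suc n)"
    using index_setD[OF i] by (simp add: D_def)
  \<comment> \<open>The differences of the arguments are the i_a, which \<open>inv of_nat\<close>
    recovers by injectivity of \<open>of_nat\<close>.\<close>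
  have diff: "inv (of_nat :: nat \<Rightarrow> complex) (of_nat (i a)) = i a"
      "c a - of_nat (k a) - \<gamma> a = of_nat (i a)" for a
    by (simp_all add: \<gamma>_def inv_f_f inj_on_def)
  \<comment> \<open>In the exponent the c_a with a <= n cancel, and D restores the i_a subtracted in
    \<gamma>.\<close>
  have "\<nu> * qpow l G * q ^ D = qpow l (- c (Suc n)) * (\<Lambda> / q ^ (\<Sum>a=1..n. k a))"
  proof -
    have G: "G + of_nat D - (\<Sum>a=1..Suc n. c a) = - c (Suc n) - of_nat (\<Sum>a=1..n. k a)"
      by (simp add: G_def \<gamma>_def D_def sum_subtractf)
    have "\<nu> * qpow l G * q ^ D = \<Lambda> * qpow l (G + of_nat D - (\<Sum>a=1..Suc n. c a))"
      by (simp only: \<nu>_def q_def qpow_of_nat[symmetric] diff_conv_add_uminus qpow_add mult_ac)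
    then show ?thesis
      unfolding G by (simp only: qpow_diff qpow_of_nat q_def mult_ac times_divide_eq_right)
  qed
  then have "qpoch (\<nu> * qpow l G) q M = qpoch (\<nu> * qpow l G) q D
      * qpoch (qpow l (- c (Suc n)) * (\<Lambda> / q ^ (\<Sum>a=1..n. k a))) q (i (Suc n))"
    unfolding M qpoch_add by simp
  \<comment> \<open>The cancellation rests on \<open>nz\<close>, as division by 0 would give
    0.\<close>
  then have F1: "qpoch (\<nu> * qpow l G) q M / qpoch \<nu> q M * (X / qpoch (\<nu> * qpow l G) q D)
      = X / qpoch \<nu> q M * qpoch (qpow l (- c (Suc n)) * (\<Lambda> / q ^ (\<Sum>a=1..n. k a))) q (i (Suc n))" for X
    using nz by (simp add: G_def)
  have F2: "qpoch (q powi (- int M)) q D = (- 1) ^ D * qpow l (of_nat (D choose 2) - of_nat M * of_nat D)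
      * (qpoch q q M / qpoch q q (i (Suc n)))"
  proof -
    have "qpow l (of_nat (D choose 2) - of_nat M * of_nat D)
        = q powi int (D choose 2) * q powi (- (int M * int D))"
      using qpow_of_int[of l "- (int M * int D)"]
      unfolding diff_conv_add_uminus qpow_add by (simp add: q_def qpow_of_nat)
    moreover have "D \<le> M" "M - D = i (Suc n)" using M by simp_all
    ultimately show ?thesis
      by (simp only: qpoch_neg_power[OF q q0] if_True)
  qed
  have "(\<Prod>a=1..n. qpoch (qpow l (\<gamma> a + 1)) q (i a) / qpoch q q (i a))
    = (\<Prod>a=1..n. (- 1) ^ i a * qpow l (of_nat (i a choose 2) + (\<gamma> a + 1) * of_nat (i a))
        * (qpoch (qpow l (- c a) * q ^ k a) q (i a) / qpoch q q (i a)))"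
  proof (intro prod.cong refl)
    fix a
    \<comment> \<open>The hypothesis of \<open>qpoch_reflect\<close>: the exponents \<gamma>_a + 1,
      k_a - c_a and i_a add up to 1.\<close>
    have "qpow l (\<gamma> a + 1) * (qpow l (- c a) * q ^ k a) * q ^ i a
        = qpow l (\<gamma> a + 1 + (- c a + of_nat (k a)) + of_nat (i a))"
      by (simp only: q_def qpow_add qpow_of_nat)
    also have "\<dots> = q"
      using qpow_of_nat[of l 1] by (simp add: \<gamma>_def q_def)
    finally have "qpoch (qpow l (\<gamma> a + 1)) q (i a)
        = (- qpow l (\<gamma> a + 1)) ^ i a * q ^ (i a choose 2) * qpoch (qpow l (- c a) * q ^ k a) q (i a)"
      using q0 by (rule qpoch_reflect)
    moreover have "(- qpow l (\<gamma> a + 1)) ^ i a * q ^ (i a choose 2)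
        = (- 1) ^ i a * qpow l (of_nat (i a choose 2) + (\<gamma> a + 1) * of_nat (i a))"
      unfolding qpow_add[of l "of_nat (i a choose 2)"] qpow_mult_of_nat
        power_minus[of "qpow l (\<gamma> a + 1)"] by (simp add: qpow_of_nat q_def)
    ultimately show "qpoch (qpow l (\<gamma> a + 1)) q (i a) / qpoch q q (i a)
        = (- 1) ^ i a * qpow l (of_nat (i a choose 2) + (\<gamma> a + 1) * of_nat (i a))
        * (qpoch (qpow l (- c a) * q ^ k a) q (i a) / qpoch q q (i a))"
      by simp
  qed
  also have "\<dots> = (- 1) ^ D * qpow l (\<Sum>a=1..n. of_nat (i a choose 2) + (\<gamma> a + 1) * of_nat (i a))
      * ((\<Prod>a=1..n. qpoch (qpow l (- c a) * q ^ k a) q (i a)) / (\<Prod>a=1..n. qpoch q q (i a)))"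
    by (simp only: prod.distrib prod_dividef qpow_sum D_def power_sum)
  finally have F3: "(\<Prod>a=1..n. qpoch (qpow l (\<gamma> a + 1)) q (i a) / qpoch q q (i a)) = \<dots>" .
  have "Phi_cont q l n M \<gamma> (\<lambda>a. c a - of_nat (k a)) \<nu>
    = qpow l (pairing n (\<lambda>a. of_nat (i a)) \<gamma> - of_nat M * G)
         * (qpoch (\<nu> * qpow l G) q M / qpoch \<nu> q M
            * (qpoch (q powi (- int M)) q D / qpoch (\<nu> * qpow l G) q D))
         * (\<Prod>a=1..n. qpoch (qpow l (\<gamma> a + 1)) q (i a) / qpoch q q (i a))"
    unfolding Phi_cont_def Let_def diff D_def G_def by (simp only: mult.assoc)
  also have "\<dots> = ((- 1) ^ D * (- 1) ^ D) * (qpow l (pairing n (\<lambda>a. of_nat (i a)) \<gamma> - of_nat M * G)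
        * qpow l (of_nat (D choose 2) - of_nat M * of_nat D)
        * qpow l (\<Sum>a=1..n. of_nat (i a choose 2) + (\<gamma> a + 1) * of_nat (i a)))
      * qpoch q q M / ((\<Prod>a=1..Suc n. qpoch q q (i a)) * qpoch \<nu> q M)
      * ((\<Prod>a=1..n. qpoch (qpow l (- c a) * q ^ k a) q (i a))
         * qpoch (qpow l (- c (Suc n)) * (\<Lambda> / q ^ (\<Sum>a=1..n. k a))) q (i (Suc n)))"
    unfolding F1 F2 F3 by (simp add: mult_ac)
  \<comment> \<open>One sign comes from (q^(-M);q)_D, the other from the reflections.\<close>
  also have "((- 1) ^ D * (- 1) ^ D :: complex) = 1"
    by (simp flip: power_mult_distrib)
  finally show ?thesis
    unfolding G_def by (simp add: qpow_add[symmetric] add.assoc diff_add_eq add_diff_eq)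
qed

text \<open>The exponents of \<open>Cfactor\<close>, of the prefactor of \<open>Acoef\<close> and of
  \<open>Phi_cont_eq\<close> are added. What remains is the exponent in \<open>B1_zpt\<close> and
  M(1-M)/2, which is offset by reflecting (\<Lambda> q^(1-M);q)_M. With all sums cut to length n and
  the pairings brought into one orientation, the claim is a polynomial identity.\<close>

lemma exponent_identity:
  fixes n M :: nat and c :: "nat \<Rightarrow> complex" and i j k :: "nat \<Rightarrow> nat"
  defines "I \<equiv> (\<lambda>a. of_nat (i a) :: complex)" and "J \<equiv> (\<lambda>a. of_nat (j a) :: complex)"
    and "K \<equiv> (\<lambda>a. of_nat (k a) :: complex)" and "D \<equiv> (\<Sum>a=1..n. i a)"
  assumes i: "i \<in> index_set (Suc n) M" and j: "j \<in> index_set (Suc n) M"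
  shows "of_nat M * ((\<Sum>a=1..Suc n. c a) - of_nat M + 1) / 2
       + (\<Sum>a=1..Suc n. of_nat (i a choose 2) - of_nat (j a choose 2)) / 2
       + (\<Sum>a=1..Suc n. c a * (J a - 2 * I a)) / 2
       + pairing (Suc n) (\<lambda>a. J a - I a) c / 2
       + (pairing (Suc n) (\<lambda>a. c a - J a) J - pairing (Suc n) I (\<lambda>a. c a - I a)) / 2
       + (pairing n I (\<lambda>a. c a - I a - K a) - of_nat M * (\<Sum>a=1..n. c a - I a - K a)
          + of_nat (D choose 2) - of_nat M * of_nat D
          + (\<Sum>a=1..n. of_nat (i a choose 2) + (c a - I a - K a + 1) * I a))
       = of_nat M * (1 - of_nat M) / 2 + pairing (Suc n) K I"
proof -
  define S where "S f = (\<Sum>a=1..n. f a)" for f :: "nat \<Rightarrow> complex"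
  have D: "of_nat D = S I" by (simp add: D_def I_def S_def)
  have M: "of_nat M = S I + I (Suc n)" "of_nat M = S J + J (Suc n)"
    using index_setD[OF i] index_setD[OF j]
    by (auto simp: S_def I_def J_def simp flip: of_nat_sum of_nat_add)
  have sw: "pairing n c J = S c * S J - pairing n J c - S (\<lambda>a. c a * J a)"
      "pairing n I K = S I * S K - pairing n K I - S (\<lambda>a. I a * K a)"
      "pairing n I I = (S I * S I - S (\<lambda>a. I a * I a)) / 2"
      "pairing n J J = (S J * S J - S (\<lambda>a. J a * J a)) / 2"
    using pairing_swap[of n c J] pairing_swap[of n I K] pairing_swap[of n I I] pairing_swap[of n J J]
    unfolding S_def by (simp_all add: field_simps)
  have choose: "(\<Sum>a=1..m. of_nat (i a choose 2)) = ((\<Sum>a=1..m. I a * I a) - (\<Sum>a=1..m. I a)) / 2"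
    "(\<Sum>a=1..m. of_nat (j a choose 2)) = ((\<Sum>a=1..m. J a * J a) - (\<Sum>a=1..m. J a)) / 2" for m
    unfolding of_nat_choose_two sum_divide_distrib[symmetric] sum_subtractf I_def J_def by simp_all
  have sums: "(\<Sum>a=1..Suc n. of_nat (i a choose 2) - of_nat (j a choose 2))
      = (S (\<lambda>a. I a * I a) + I (Suc n) * I (Suc n) - (S I + I (Suc n))) / 2
        - (S (\<lambda>a. J a * J a) + J (Suc n) * J (Suc n) - (S J + J (Suc n))) / 2"
    unfolding sum_subtractf choose S_def by simp
  have sums': "(\<Sum>a=1..Suc n. c a * (J a - 2 * I a))
      = S (\<lambda>a. c a * J a) - 2 * S (\<lambda>a. c a * I a) + c (Suc n) * (J (Suc n) - 2 * I (Suc n))"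
    "(\<Sum>a=1..n. c a - I a - K a) = S c - S I - S K"
    "(\<Sum>a=1..Suc n. c a) = S c + c (Suc n)"
    unfolding S_def by (simp_all add: sum_subtractf sum_distrib_left right_diff_distrib mult.left_commute)
  have sums'': "(\<Sum>a=1..n. of_nat (i a choose 2) + (c a - I a - K a + 1) * I a)
      = (S (\<lambda>a. I a * I a) - S I) / 2 + (S (\<lambda>a. c a * I a) - S (\<lambda>a. I a * I a) - S (\<lambda>a. I a * K a) + S I)"
    unfolding sum.distrib choose S_def
    by (simp add: sum.distrib sum_subtractf algebra_simps)
  have pairs: "pairing (Suc n) (\<lambda>a. J a - I a) c = pairing n J c - pairing n I c + (S J - S I) * c (Suc n)"
    "pairing (Suc n) (\<lambda>a. c a - J a) J = pairing n c J - pairing n J J + (S c - S J) * J (Suc n)"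
    "pairing (Suc n) I (\<lambda>a. c a - I a) = pairing n I c - pairing n I I + S I * (c (Suc n) - I (Suc n))"
    "pairing n I (\<lambda>a. c a - I a - K a) = pairing n I c - pairing n I I - pairing n I K"
    "pairing (Suc n) K I = pairing n K I + S K * I (Suc n)"
    unfolding S_def by (simp_all add: pairing_Suc pairing_diff_left pairing_diff_right pairing_add_right sum_subtractf algebra_simps)
  \<comment> \<open>The common total M of i and j eliminates the last entry of j.\<close>
  have J': "J (Suc n) = S I + I (Suc n) - S J"
    using M by (simp add: algebra_simps)
  show ?thesis
    unfolding sums sums' sums'' pairs sw
    unfolding of_nat_choose_two D M(1) J'
    by (simp add: field_simps)
qed

text \<open>\<open>Phi\<close> vanishes unless 0 <= k_a <= j_a, so the infinite sum reduces to the
  image of the finite box under the embedding into integer sequences.\<close>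

lemma Acoef_eq:
  fixes l \<Lambda> :: complex and n M :: nat and i j :: "nat \<Rightarrow> nat" and c :: "nat \<Rightarrow> complex"
  shows "Acoef q l (Suc n) M \<Lambda> (\<lambda>a. c a - of_nat (i a)) i (\<lambda>a. c a - of_nat (j a)) j
    = qpow l ((pairing (Suc n) (\<lambda>a. c a - of_nat (j a)) (\<lambda>a. of_nat (j a))
         - pairing (Suc n) (\<lambda>a. of_nat (i a)) (\<lambda>a. c a - of_nat (i a))) / 2)
      * (\<Sum>k\<in>lower_seqs n j. Phi q n (\<lambda>a. int (k a)) (\<lambda>a. int (j a)) (1 / \<Lambda>) (q powi (- int M))
          * Phi_cont q l n M (\<lambda>a. c a - of_nat (i a) - of_nat (k a)) (\<lambda>a. c a - of_nat (k a))
                  (\<Lambda> * qpow l (- (\<Sum>a=1..Suc n. c a))))"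
proof -
  define F where "F k = Phi q n k (\<lambda>a. int (j a)) (1 / \<Lambda>) (q powi (- int M))
      * Phi_cont q l n M (\<lambda>a. c a - of_nat (i a) - of_int (k a)) (\<lambda>a. c a - of_int (k a))
          (\<Lambda> * qpow l (- (\<Sum>a=1..Suc n. c a)))" for k
  define \<iota> where "\<iota> = (\<lambda>(k :: nat \<Rightarrow> nat) a. int (k a))"
  have inj: "inj_on \<iota> (lower_seqs n j)"
    by (auto simp: inj_on_def \<iota>_def fun_eq_iff)
  have "(\<Sum>\<^sub>\<infinity>k\<in>int_seqs n. F k) = (\<Sum>\<^sub>\<infinity>k\<in>\<iota> ` lower_seqs n j. F k)"
  proof (intro infsum_cong_neutral refl)
    fix k assume "k \<in> \<iota> ` lower_seqs n j - int_seqs n"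
    then show "F k = 0" by (auto simp: \<iota>_def lower_seqs_def int_seqs_def)
  next
    fix k assume k: "k \<in> int_seqs n - \<iota> ` lower_seqs n j"
    have "\<not> (\<forall>a\<in>{1..n}. 0 \<le> k a \<and> k a \<le> int (j a))"
    proof
      assume *: "\<forall>a\<in>{1..n}. 0 \<le> k a \<and> k a \<le> int (j a)"
      have "k a \<ge> 0" for a
        using k * by (cases "a \<in> {1..n}") (auto simp: int_seqs_def)
      then have "k = \<iota> (\<lambda>a. nat (k a))"
        by (simp add: \<iota>_def fun_eq_iff)
      moreover have "(\<lambda>a. nat (k a)) \<in> lower_seqs n j"
        using k * by (auto simp: lower_seqs_def int_seqs_def)
      ultimately show False using k by blast
    qed
    then show "F k = 0"
      unfolding F_def Phi_def by (simp only: if_not_P if_False mult_zero_left)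
  qed
  also have "\<dots> = (\<Sum>k\<in>lower_seqs n j. F (\<iota> k))"
    by (simp add: infsum_finite finite_lower_seqs sum.reindex[OF inj])
  finally show ?thesis
    by (simp add: Acoef_def Let_def F_def \<iota>_def)
qed

text \<open>The left side is the claimed coefficient, the right side what inversion at the points
  \<open>zpt q k\<close> produces. After \<open>Phi_cont_eq\<close> for each k,
  \<open>exponent_identity\<close> combines the powers of q into the one contained in B1.\<close>

lemma coefficient_eq:
  fixes l \<Lambda> :: complex and n M :: nat and i j :: "nat \<Rightarrow> nat" and c :: "nat \<Rightarrow> complex"
  defines "q \<equiv> exp l"
  defines "\<nu> \<equiv> \<Lambda> * qpow l (- (\<Sum>a=1..Suc n. c a))"
  assumes q: "norm q < 1" and i: "i \<in> index_set (Suc n) M" and j: "j \<in> index_set (Suc n) M"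
    and \<Lambda>: "\<Lambda> \<noteq> 0" and \<nu>: "qpoch \<nu> q M \<noteq> 0"
    and nz: "\<And>k. k \<in> lower_seqs n j \<Longrightarrow>
      qpoch (\<nu> * qpow l (\<Sum>a=1..n. c a - of_nat (i a) - of_nat (k a))) q (\<Sum>a=1..n. i a) \<noteq> 0"
  shows "Cfactor l (Suc n) M c i j * (qpoch \<nu> q M / qpoch (\<Lambda> * q powi (1 - int M)) q M)
      * (\<Prod>a=1..Suc n. qpoch q q (i a) / qpoch q q (j a))
      * Acoef q l (Suc n) M \<Lambda> (\<lambda>a. c a - of_nat (i a)) i (\<lambda>a. c a - of_nat (j a)) j
    = qpoch q q M / ((\<Prod>a=1..Suc n. qpoch q q (j a)) * (\<Lambda> ^ M * qpoch (1 / \<Lambda>) q M))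
      * (\<Sum>k\<in>lower_seqs n j. Phi q n (\<lambda>a. int (k a)) (\<lambda>a. int (j a)) (1 / \<Lambda>) (q powi (- int M))
          * B1 q (Suc n) (\<lambda>a. qpow l (- c a)) i (zpt q k) \<Lambda>)"
proof -
  have q0: "q \<noteq> 0" by (simp add: q_def)
  define W where "W k = Phi q n (\<lambda>a. int (k a)) (\<lambda>a. int (j a)) (1 / \<Lambda>) (q powi (- int M))" for k
  \<comment> \<open>\<open>E0\<close>, \<open>E1\<close>, \<open>E2\<close> are the exponents from
    \<open>Cfactor\<close>, from the prefactor of \<open>Acoef\<close> and from
    \<open>Phi_cont_eq\<close>; \<open>b\<close> is B1 at the point without its power of q.\<close>
  define E0 where "E0 = of_nat M * ((\<Sum>a=1..Suc n. c a) - of_nat M + 1) / 2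
       + (\<Sum>a=1..Suc n. of_nat (i a choose 2) - of_nat (j a choose 2)) / 2
       + (\<Sum>a=1..Suc n. c a * (of_nat (j a) - 2 * of_nat (i a))) / 2
       + pairing (Suc n) (\<lambda>a. of_nat (j a) - of_nat (i a)) c / 2"
  define E1 where "E1 = (pairing (Suc n) (\<lambda>a. c a - of_nat (j a)) (\<lambda>a. of_nat (j a))
         - pairing (Suc n) (\<lambda>a. of_nat (i a)) (\<lambda>a. c a - of_nat (i a))) / 2"
  define E2 where "E2 k = pairing n (\<lambda>a. of_nat (i a)) (\<lambda>a. c a - of_nat (i a) - of_nat (k a))
        - of_nat M * (\<Sum>a=1..n. c a - of_nat (i a) - of_nat (k a))
        + of_nat ((\<Sum>a=1..n. i a) choose 2) - of_nat M * of_nat (\<Sum>a=1..n. i a)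
        + (\<Sum>a=1..n. of_nat (i a choose 2) + (c a - of_nat (i a) - of_nat (k a) + 1) * of_nat (i a))"
    for k :: "nat \<Rightarrow> nat"
  define b where "b k = (\<Prod>a=1..n. qpoch (qpow l (- c a) * q ^ k a) q (i a))
         * qpoch (qpow l (- c (Suc n)) * (\<Lambda> / q ^ (\<Sum>a=1..n. k a))) q (i (Suc n))" for k
  define X where "X = of_nat M * (1 - of_nat M) / (2 :: complex)"
  have E: "qpow l E0 * (qpow l E1 * (qpow l (E2 k) * b k))
      = qpow l X * B1 q (Suc n) (\<lambda>a. qpow l (- c a)) i (zpt q k) \<Lambda>" for k
  proof -
    have "E0 + E1 + E2 k = X + pairing (Suc n) (\<lambda>a. of_nat (k a)) (\<lambda>a. of_nat (i a))"
      using exponent_identity[OF i j, of c k] by (simp only: E0_def E1_def E2_def X_def)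
    also have "pairing (Suc n) (\<lambda>a. of_nat (k a)) (\<lambda>a. of_nat (i a))
        = (of_int (pairing (Suc n) (\<lambda>a. int (k a)) (\<lambda>a. int (i a))) :: complex)"
      by (simp add: of_int_pairing)
    finally have "qpow l E0 * (qpow l E1 * qpow l (E2 k))
        = qpow l X * q powi pairing (Suc n) (\<lambda>a. int (k a)) (\<lambda>a. int (i a))"
      by (simp only: qpow_add[symmetric] qpow_of_int[symmetric] q_def add.assoc)
    then show ?thesis
      unfolding B1_zpt[OF q0] b_def by (simp add: mult_ac)
  qed
  \<comment> \<open>The power of q from this reflection has exponent \<open>X\<close>, exactly the
    remainder free of k in \<open>exponent_identity\<close>.\<close>
  have Lam: "qpoch (\<Lambda> * q powi (1 - int M)) q M = (- 1) ^ M * qpow l X * (\<Lambda> ^ M * qpoch (1 / \<Lambda>) q M)"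
  proof -
    have "\<Lambda> * q powi (1 - int M) * (1 / \<Lambda>) * q ^ M = q"
      using \<Lambda> q0 by (simp add: power_int_diff)
    then have "qpoch (\<Lambda> * q powi (1 - int M)) q M
        = (- (\<Lambda> * q powi (1 - int M))) ^ M * q ^ (M choose 2) * qpoch (1 / \<Lambda>) q M"
      using q0 by (rule qpoch_reflect)
    also have "(- (\<Lambda> * q powi (1 - int M))) ^ M = (- 1) ^ M * \<Lambda> ^ M * qpow l ((1 - of_nat M) * of_nat M)"
    proof -
      have "q powi (1 - int M) = qpow l (1 - of_nat M)"
        using qpow_of_int[of l "1 - int M"] by (simp add: q_def)
      then show ?thesis
        by (subst power_minus) (simp only: power_mult_distrib qpow_mult_of_nat mult.assoc)
    qed
    also have "(- 1) ^ M * \<Lambda> ^ M * qpow l ((1 - of_nat M) * of_nat M) * q ^ (M choose 2)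
        = (- 1) ^ M * \<Lambda> ^ M * qpow l ((1 - of_nat M) * of_nat M + of_nat (M choose 2))"
      by (simp add: qpow_add qpow_of_nat q_def)
    also have "(1 - of_nat M) * of_nat M + of_nat (M choose 2) = X"
      by (simp add: of_nat_choose_two X_def field_simps)
    finally show ?thesis by (simp add: mult_ac)
  qed
  have "Acoef q l (Suc n) M \<Lambda> (\<lambda>a. c a - of_nat (i a)) i (\<lambda>a. c a - of_nat (j a)) j
    = qpow l E1 * (\<Sum>k\<in>lower_seqs n j. W k * (qpow l (E2 k) * qpoch q q M
         / ((\<Prod>a=1..Suc n. qpoch q q (i a)) * qpoch \<nu> q M) * b k))"
    unfolding Acoef_eq E1_def W_def
    by (intro arg_cong2[where f="(*)"] sum.cong refl)
       (simp only: Phi_cont_eq[OF q[unfolded q_def] i nz[unfolded \<nu>_def q_def]] \<nu>_def q_def E2_def b_def)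
  also have "\<dots> = qpoch q q M / ((\<Prod>a=1..Suc n. qpoch q q (i a)) * qpoch \<nu> q M)
      * (\<Sum>k\<in>lower_seqs n j. W k * (qpow l E1 * (qpow l (E2 k) * b k)))"
    unfolding sum_distrib_left by (intro sum.cong refl) simp
  finally have A: "Acoef q l (Suc n) M \<Lambda> (\<lambda>a. c a - of_nat (i a)) i (\<lambda>a. c a - of_nat (j a)) j = \<dots>" .
  have "qpow l E0 * (\<Sum>k\<in>lower_seqs n j. W k * (qpow l E1 * (qpow l (E2 k) * b k)))
      = (\<Sum>k\<in>lower_seqs n j. W k * (qpow l E0 * (qpow l E1 * (qpow l (E2 k) * b k))))"
    unfolding sum_distrib_left by (intro sum.cong refl) simp
  also have "\<dots> = qpow l X * (\<Sum>k\<in>lower_seqs n j. W k * B1 q (Suc n) (\<lambda>a. qpow l (- c a)) i (zpt q k) \<Lambda>)"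
    unfolding E sum_distrib_left by (intro sum.cong refl) simp
  finally have S: "qpow l E0 * (\<Sum>k\<in>lower_seqs n j. W k * (qpow l E1 * (qpow l (E2 k) * b k))) = \<dots>" .
  \<comment> \<open>The bare algebra of the last cancellation: \<sigma> is the sign, e and x are the
    powers with exponents \<open>E0\<close> and \<open>X\<close>, v is (\<nu>;q)_M, and p, r are the
    products over i and j.\<close>
  have cancel: "(\<sigma> * e) * (v / (\<sigma> * x * L)) * (p / r) * (m / (p * v) * s) = m / (r * L) * s'"
    if "\<sigma> \<noteq> 0" "x \<noteq> 0" "p \<noteq> 0" "v \<noteq> 0" "e * s = x * s'"
    for \<sigma> e v x L p r m s s' :: complex
  proof -
    have "(\<sigma> * e) * (v / (\<sigma> * x * L)) * (p / r) * (m / (p * v) * s) = m / (r * L) * ((e * s) / x)"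
      using that(1-4) by (simp add: mult_ac)
    then show ?thesis using that(2,5) by simp
  qed
  have "(\<Prod>a=1..Suc n. qpoch q q (i a)) \<noteq> 0"
    using qpoch_qq_nonzero[OF q] by (simp add: prod_zero_iff)
  moreover have "Cfactor l (Suc n) M c i j = (- 1) ^ M * qpow l E0"
    by (simp add: Cfactor_def E0_def)
  ultimately show ?thesis
    unfolding A Lam W_def[symmetric] prod_dividef
    by (simp only:) (rule cancel[OF _ qpow_nonzero _ \<nu> S]; simp)
qed

subsection \<open>Spaces of forms\<close>

text \<open>Polynomials are handled as functions under pointwise operations, so that linear
  relations can be tested by evaluation.\<close>

interpretation polyfun: vector_space "\<lambda>(r::complex) (f::(nat \<Rightarrow> complex) \<Rightarrow> complex) z. r * f z"
  by unfold_locales (auto simp: fun_eq_iff algebra_simps)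

text \<open>The condition on coefficients makes b injective on I with independent image. If f lay
  outside its span, adding f would give an independent subset of \<open>span T\<close> with more
  than \<open>card T\<close> elements.\<close>

lemma (in vector_space) independent_family_spans:
  assumes "finite T" "finite I" "card T \<le> card I" "b ` I \<subseteq> span T"
    and indep: "\<And>x. (\<Sum>j\<in>I. scale (x j) (b j)) = 0 \<Longrightarrow> \<forall>j\<in>I. x j = 0"
    and f: "f \<in> span T"
  shows "\<exists>x. f = (\<Sum>j\<in>I. scale (x j) (b j))"
proof -
  have inj: "inj_on b I"
  proof (rule inj_onI, rule ccontr)
    fix i j assume ij: "i \<in> I" "j \<in> I" "b i = b j" "i \<noteq> j"
    \<comment> \<open>A repeated member would give the relation b i - b j = 0 with nonzero
      coefficients.\<close>
    define x where "x k = (if k = i then 1 else 0) - (if k = j then 1 else 0 :: 'a)" for k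
    have "(\<Sum>k\<in>I. scale (x k) (b k))
        = (\<Sum>k\<in>I. if k = i then b k else 0) - (\<Sum>k\<in>I. if k = j then b k else 0)"
      unfolding sum_subtractf[symmetric] x_def
      by (intro sum.cong refl) (auto simp: scale_left_diff_distrib)
    also have "\<dots> = 0"
      using ij assms(2) by simp
    finally have "x i = 0" using indep ij by blast
    then show False using ij by (simp add: x_def)
  qed
  have "independent (b ` I)"
  proof
    assume "dependent (b ` I)"
    then obtain u v where v: "v \<in> b ` I" "u v \<noteq> 0" and "(\<Sum>v\<in>b ` I. scale (u v) v) = 0"
      using dependent_finite[of "b ` I"] assms(2) by auto
    then have "(\<Sum>j\<in>I. scale (u (b j)) (b j)) = 0"
      by (simp add: sum.reindex[OF inj] o_def)
    then have "\<forall>j\<in>I. u (b j) = 0" by (rule indep)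
    then show False using v by auto
  qed
  moreover have "f \<in> span (b ` I)"
  proof (rule ccontr)
    assume nf: "f \<notin> span (b ` I)"
    then have "independent (insert f (b ` I))"
      using \<open>independent (b ` I)\<close> by (rule independent_insertI)
    then have "card (insert f (b ` I)) \<le> card T"
      using independent_span_bound[of T "insert f (b ` I)"] assms f by blast
    moreover have "f \<notin> b ` I"
      using nf span_base by blast
    ultimately show False
      using assms(2,3) by (simp add: card_image[OF inj])
  qed
  then obtain u where "f = (\<Sum>v\<in>b ` I. scale (u v) v)"
    using span_finite[of "b ` I"] assms(2) by auto
  then have "f = (\<Sum>j\<in>I. scale (u (b j)) (b j))"
    by (simp add: sum.reindex[OF inj] o_def)
  then show ?thesis by (intro exI[of _ "\<lambda>j. u (b j)"])
qed

lemma sum_polyfun_apply: "(\<Sum>j\<in>I. (\<lambda>z. x j * b j z)) z = (\<Sum>j\<in>I. x j * (b j z :: complex))"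
  by (induction I rule: infinite_finite_induct) auto

lemma finite_index_set: "finite (index_set N M)"
proof (rule finite_subset)
  show "index_set N M \<subseteq> lower_seqs N (\<lambda>_. M)"
  proof
    fix i assume i: "i \<in> index_set N M"
    have "i a \<le> (\<Sum>a=1..N. i a)" if "a \<in> {1..N}" for a
      using that by (intro member_le_sum) auto
    then show "i \<in> lower_seqs N (\<lambda>_. M)"
      using i by (auto simp: index_set_def lower_seqs_def)
  qed
qed (rule finite_lower_seqs)

section \<open>Homogeneous polynomials as functions\<close>

definition monomial :: "nat \<Rightarrow> (nat \<Rightarrow> nat) \<Rightarrow> (nat \<Rightarrow> complex) \<Rightarrow> complex" where
  "monomial N i z = (\<Prod>a=1..N. z a ^ i a)"

definition forms :: "nat \<Rightarrow> nat \<Rightarrow> ((nat \<Rightarrow> complex) \<Rightarrow> complex) set" where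
  "forms N d = polyfun.span (monomial N ` index_set N d)"

lemma forms_one: "(\<lambda>z. 1) \<in> forms N 0"
proof -
  have "(\<lambda>z. 1) = monomial N (\<lambda>_. 0)"
    by (simp add: fun_eq_iff monomial_def)
  moreover have "(\<lambda>_. 0) \<in> index_set N 0"
    by (simp add: index_set_def)
  ultimately show ?thesis
    unfolding forms_def by (intro polyfun.span_base) auto
qed

lemma forms_add: "f \<in> forms N d \<Longrightarrow> g \<in> forms N d \<Longrightarrow> (\<lambda>z. f z + g z) \<in> forms N d"
  using polyfun.span_add[of f _ g] by (simp add: forms_def plus_fun_def)

lemma forms_scale: "f \<in> forms N d \<Longrightarrow> (\<lambda>z. r * f z) \<in> forms N d"
  unfolding forms_def by (rule polyfun.span_scale)

text \<open>A monomial has one exponent raised; the general case follows by linearity.\<close>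

lemma forms_mult_var:
  assumes "f \<in> forms N d" and b: "b \<in> {1..N}"
  shows "(\<lambda>z. z b * f z) \<in> forms N (Suc d)"
  using assms(1)[unfolded forms_def]
proof (induction rule: polyfun.span_induct_alt)
  case base
  show ?case using polyfun.span_zero by (simp add: forms_def zero_fun_def)
next
  case (step r g h)
  then obtain i where i: "i \<in> index_set N d" and g: "g = monomial N i" by auto
  let ?i = "i(b := Suc (i b))"
  have "monomial N ?i z = z b * monomial N i z" for z
  proof -
    have "monomial N ?i z = (\<Prod>a=1..N. (if a = b then z b else 1) * z a ^ i a)"
      unfolding monomial_def by (intro prod.cong) auto
    then show ?thesis
      using b by (simp add: prod.distrib monomial_def)
  qed
  moreover have "?i \<in> index_set N (Suc d)"
  proof -
    have "(\<Sum>a=1..N. ?i a) = (\<Sum>a=1..N. (if a = b then 1 else 0) + i a)"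
      by (intro sum.cong) auto
    then show ?thesis
      using b i by (auto simp: sum.distrib index_set_def)
  qed
  ultimately have "(\<lambda>z. z b * g z) \<in> forms N (Suc d)"
    unfolding g forms_def by (intro polyfun.span_base) (auto simp: fun_eq_iff intro!: image_eqI[of _ _ ?i])
  then have "(\<lambda>z. r * (z b * g z) + z b * h z) \<in> forms N (Suc d)"
    using step by (intro forms_add forms_scale)
  then show ?case by (simp add: algebra_simps)
qed

lemma forms_mult_linear:
  assumes "f \<in> forms N d" "a \<in> {1..N}" "b \<in> {1..N}"
  shows "(\<lambda>z. (r * z a + s * z b) * f z) \<in> forms N (Suc d)"
proof -
  have "(\<lambda>z. r * (z a * f z) + s * (z b * f z)) \<in> forms N (Suc d)"
    using assms by (intro forms_add forms_scale forms_mult_var)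
  then show ?thesis by (simp add: algebra_simps)
qed

lemma forms_mult_prod_linear:
  assumes "f \<in> forms N d" "a \<in> {1..N}" "b \<in> {1..N}"
  shows "(\<lambda>z. (\<Prod>t<m. r t * z a + s t * z b) * f z) \<in> forms N (d + m)"
proof (induction m)
  case (Suc m)
  then show ?case
    using forms_mult_linear[OF Suc assms(2,3), of "r m" "s m"] by (simp add: mult_ac)
qed (use assms in simp)

text \<open>The division-free shape common to B1 and B2: linear forms in cyclically adjacent
  variables, with \<Lambda> moved into the coefficients s. It keeps its polynomial values where some
  z_a vanish.\<close>

definition cyclic_prod ::
  "nat \<Rightarrow> (nat \<Rightarrow> nat \<Rightarrow> complex) \<Rightarrow> (nat \<Rightarrow> nat \<Rightarrow> complex) \<Rightarrow> (nat \<Rightarrow> nat) \<Rightarrow> (nat \<Rightarrow> complex) \<Rightarrow> complex"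
  where "cyclic_prod N r s i z =
    (\<Prod>a=1..N. \<Prod>t<i a. r a t * z a + s a t * z (if a = N then 1 else Suc a))"

lemma cyclic_prod_in_forms:
  assumes "i \<in> index_set N M"
  shows "cyclic_prod N r s i \<in> forms N M"
proof -
  \<comment> \<open>The induction is on the number n of factors kept, while the wrap-around index
    stays at N.\<close>
  have "(\<lambda>z. \<Prod>a=1..n. \<Prod>t<i a. r a t * z a + s a t * z (if a = N then 1 else Suc a))
      \<in> forms N (\<Sum>a=1..n. i a)" if "n \<le> N" for n
    using that
  proof (induction n)
    case 0
    show ?case by (simp add: forms_one)
  next
    case (Suc n)
    let ?v = "if Suc n = N then 1 else Suc (Suc n)"
    have "(\<lambda>z. (\<Prod>t<i (Suc n). r (Suc n) t * z (Suc n) + s (Suc n) t * z ?v)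
        * (\<Prod>a=1..n. \<Prod>t<i a. r a t * z a + s a t * z (if a = N then 1 else Suc a)))
      \<in> forms N ((\<Sum>a=1..n. i a) + i (Suc n))"
      using Suc by (intro forms_mult_prod_linear) auto
    moreover have "(\<Prod>a=1..Suc n. g a) = g (Suc n) * (\<Prod>a=1..n. g a)" for g :: "nat \<Rightarrow> complex"
      by simp
    moreover have "(\<Sum>a=1..Suc n. i a) = (\<Sum>a=1..n. i a) + i (Suc n)"
      by simp
    ultimately show ?case by (simp only:)
  qed
  from this[of N] show ?thesis
    using assms unfolding cyclic_prod_def index_set_def by simp
qed

lemma qpoch_mult_power:
  assumes "x \<noteq> 0"
  shows "qpoch (u / x) q n * x ^ n = (\<Prod>t<n. x - u * q ^ t)"
  using assms by (induction n) (simp_all add: qpoch_Suc field_simps)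

lemma B1_eq_cyclic_prod:
  assumes "\<forall>a\<in>{1..N}. z a \<noteq> 0" and "N \<ge> 1"
  shows "B1 q N \<mu> i z \<Lambda> =
    cyclic_prod N (\<lambda>a t. 1) (\<lambda>a t. - (\<mu> a * (if a = N then \<Lambda> else 1) * q ^ t)) i z"
  unfolding B1_def cyclic_prod_def
proof (intro prod.cong refl)
  fix a assume a: "a \<in> {1..N}"
  then have "qpoch (\<mu> a * zext N \<Lambda> z (a + 1) / z a) q (i a) * z a ^ i a
     = (\<Prod>t<i a. z a - \<mu> a * zext N \<Lambda> z (a + 1) * q ^ t)"
    using assms by (intro qpoch_mult_power) auto
  then show "qpoch (\<mu> a * (zext N \<Lambda> z (a + 1) / zext N \<Lambda> z a)) q (i a) * zext N \<Lambda> z a ^ i a =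
      (\<Prod>t<i a. 1 * z a + - (\<mu> a * (if a = N then \<Lambda> else 1) * q ^ t) * z (if a = N then 1 else Suc a))"
    using a by (auto simp: zext_def mult_ac)
qed

lemma B2_eq_cyclic_prod:
  assumes "\<forall>a\<in>{1..N}. z a \<noteq> 0" and "N \<ge> 1" and "\<Lambda> \<noteq> 0"
  shows "B2 q N i z \<Lambda> = cyclic_prod N (\<lambda>a t. - (q ^ t)) (\<lambda>a t. if a = N then \<Lambda> else 1) i z"
  unfolding B2_def cyclic_prod_def
proof (intro prod.cong refl)
  fix a assume a: "a \<in> {1..N}"
  then have "qpoch (z a / zext N \<Lambda> z (a + 1)) q (i a) * zext N \<Lambda> z (a + 1) ^ i a
     = (\<Prod>t<i a. zext N \<Lambda> z (a + 1) - z a * q ^ t)"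
    using assms by (intro qpoch_mult_power) (auto simp: zext_def)
  then show "qpoch (zext N \<Lambda> z a / zext N \<Lambda> z (a + 1)) q (i a) * zext N \<Lambda> z (a + 1) ^ i a =
      (\<Prod>t<i a. - (q ^ t) * z a + (if a = N then \<Lambda> else 1) * z (if a = N then 1 else Suc a))"
    using a by (auto simp: zext_def mult_ac)
qed

subsection \<open>The expansion\<close>

text \<open>The zeros in \<Lambda> are among the finitely many values 1/(u q^t) with t < n.\<close>

lemma eventually_qpoch_nonzero:
  assumes "u \<noteq> 0" and "q \<noteq> 0"
  shows "\<forall>\<^sub>F \<Lambda> in cofinite. qpoch (\<Lambda> * u) q n \<noteq> 0"
proof -
  have "{\<Lambda>. \<not> qpoch (\<Lambda> * u) q n \<noteq> 0} \<subseteq> (\<lambda>t. 1 / (u * q ^ t)) ` {..<n}"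
  proof
    fix \<Lambda> assume "\<Lambda> \<in> {\<Lambda>. \<not> qpoch (\<Lambda> * u) q n \<noteq> 0}"
    then obtain t where "t < n" "\<Lambda> * (u * q ^ t) = 1"
      by (auto simp: qpoch_def mult.assoc)
    then show "\<Lambda> \<in> (\<lambda>t. 1 / (u * q ^ t)) ` {..<n}"
      using assms by (intro image_eqI[of _ _ t]) (auto simp: eq_divide_eq)
  qed
  then show ?thesis
    unfolding eventually_cofinite by (rule finite_subset) simp
qed

theorem corollary3p5:
  fixes q l :: complex and N M :: nat and c :: "nat \<Rightarrow> complex"
  assumes "0 < norm q" and "norm q < 1" and "exp l = q" and "N \<ge> 2"
  shows "\<forall>\<^sub>F \<Lambda> in cofinite.
    let expansion = (\<lambda>R :: (nat \<Rightarrow> nat) \<Rightarrow> (nat \<Rightarrow> nat) \<Rightarrow> complex.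
          \<forall>i\<in>index_set N M. \<forall>z. (\<forall>a\<in>{1..N}. z a \<noteq> 0) \<longrightarrow>
            B1 q N (\<lambda>a. qpow l (- c a)) i z \<Lambda> = (\<Sum>j\<in>index_set N M. R i j * B2 q N j z \<Lambda>))
    in (\<exists>R. expansion R) \<and>
       (\<forall>R. expansion R \<longrightarrow> (\<forall>i\<in>index_set N M. \<forall>j\<in>index_set N M.
          R i j = Cfactor l N M c i j
            * (qpoch (\<Lambda> * qpow l (- (\<Sum>a=1..N. c a))) q M / qpoch (\<Lambda> * q powi (1 - int M)) q M)
            * (\<Prod>a=1..N. qpoch q q (i a) / qpoch q q (j a))
            * Acoef q l N M \<Lambda> (\<lambda>a. c a - of_nat (i a)) i (\<lambda>a. c a - of_nat (j a)) j))"
proof -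
  obtain n where N: "N = Suc n"
    using \<open>N \<ge> 2\<close> by (cases N) auto
  have q: "norm q < 1" "q \<noteq> 0" and l: "exp l = q"
    using assms by auto
  let ?I = "index_set (Suc n) M"
  define \<mu> where "\<mu> a = qpow l (- c a)" for a
  define s where "s = qpow l (- (\<Sum>a=1..Suc n. c a))"
  define g where "g i k = qpow l (\<Sum>a=1..n. c a - of_nat (i a) - of_nat (k a))" for i k :: "nat \<Rightarrow> nat"
  \<comment> \<open>These are the denominators in \<open>Phi_cont\<close> for all i, j, k that
    occur; there are finitely many of them, each with finitely many zeros in \<Lambda>.\<close>
  have ev: "\<forall>\<^sub>F \<Lambda> in cofinite. \<forall>i\<in>?I. \<forall>j\<in>?I. \<forall>k\<in>lower_seqs n j. qpoch (\<Lambda> * (s * g i k)) q (\<Sum>a=1..n. i a) \<noteq> 0"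
    by (intro eventually_ball_finite ballI finite_index_set finite_lower_seqs eventually_qpoch_nonzero)
       (simp_all add: s_def g_def q)
  have "\<forall>\<^sub>F \<Lambda> in cofinite. qpoch (\<Lambda> * s) q M \<noteq> 0"
    "\<forall>\<^sub>F \<Lambda> in cofinite. qpoch (\<Lambda> * q powi (1 - int M)) q M \<noteq> 0"
    "\<forall>\<^sub>F \<Lambda> in cofinite. \<Lambda> \<noteq> (0 :: complex)"
    using eventually_qpoch_nonzero[of s q M] eventually_qpoch_nonzero[of "q powi (1 - int M)" q M] q
    by (simp_all add: eventually_cofinite s_def)
  then show ?thesis
    using ev
  proof eventually_elim
    case (elim \<Lambda>)
    have \<Lambda>: "\<Lambda> \<noteq> 0" and \<nu>: "qpoch (\<Lambda> * s) q M \<noteq> 0"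
      and \<Lambda>M: "qpoch (\<Lambda> * q powi (1 - int M)) q M \<noteq> 0"
      using elim by auto
    \<comment> \<open>By reflection, (1/\<Lambda>;q)_M vanishes only together with (\<Lambda>
      q^(1-M);q)_M.\<close>
    have \<Lambda>': "qpoch (1 / \<Lambda>) q M \<noteq> 0"
    proof -
      have "\<Lambda> * q powi (1 - int M) * (1 / \<Lambda>) * q ^ M = q"
        using \<Lambda> q by (simp add: power_int_diff)
      then show ?thesis
        using qpoch_reflect[of "\<Lambda> * q powi (1 - int M)" "1 / \<Lambda>" q M] q(2) \<Lambda>M by auto
    qed
    define W where "W k j = Phi q n (\<lambda>a. int (k a)) (\<lambda>a. int (j a)) (1 / \<Lambda>) (q powi (- int M))"
      for k j :: "nat \<Rightarrow> nat"
    \<comment> \<open>The reciprocal of the diagonal value in \<open>sum_Phi_B2_zpt\<close>, so that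
      \<open>orth\<close> yields a Kronecker delta.\<close>
    define \<kappa> where "\<kappa> j = qpoch q q M / ((\<Prod>a=1..Suc n. qpoch q q (j a)) * (\<Lambda> ^ M * qpoch (1 / \<Lambda>) q M))"
      for j :: "nat \<Rightarrow> nat"
    have orth: "\<kappa> j * (\<Sum>k\<in>lower_seqs n j. W k j * B2 q (Suc n) i (zpt q k) \<Lambda>) = (if i = j then 1 else 0)"
      if "i \<in> ?I" "j \<in> ?I" for i j
    proof -
      have "(\<Prod>a=1..Suc n. qpoch q q (j a)) \<noteq> 0"
        using qpoch_qq_nonzero[OF q(1)] by (simp add: prod_zero_iff)
      then show ?thesis
        unfolding W_def sum_Phi_B2_zpt[OF q \<Lambda> that] \<kappa>_def
        using \<Lambda> \<Lambda>' qpoch_qq_nonzero[OF q(1), of M] by simp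
    qed
    \<comment> \<open>Coefficients with respect to the B2 are read off from values at the points
      \<open>zpt q k\<close>, whose coordinates are nonzero. This serves twice: with f = 0 for
      linear independence, and with f = B1 for the formula.\<close>
    have coeff: "x j = \<kappa> j * (\<Sum>k\<in>lower_seqs n j. W k j * f (zpt q k))"
      if f: "\<And>z. \<forall>a\<in>{1..Suc n}. z a \<noteq> 0 \<Longrightarrow> f z = (\<Sum>i\<in>?I. x i * B2 q (Suc n) i z \<Lambda>)"
        and j: "j \<in> ?I" for f x j
    proof -
      have "\<kappa> j * (\<Sum>k\<in>lower_seqs n j. W k j * f (zpt q k))
          = \<kappa> j * (\<Sum>k\<in>lower_seqs n j. \<Sum>i\<in>?I. x i * (W k j * B2 q (Suc n) i (zpt q k) \<Lambda>))"
        by (simp add: f zpt_nonzero q sum_distrib_left mult_ac)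
      also have "\<dots> = (\<Sum>i\<in>?I. x i * (\<kappa> j * (\<Sum>k\<in>lower_seqs n j. W k j * B2 q (Suc n) i (zpt q k) \<Lambda>)))"
        by (subst sum.swap) (simp add: sum_distrib_left mult_ac)
      also have "\<dots> = (\<Sum>i\<in>?I. if i = j then x i else 0)"
        by (intro sum.cong refl) (simp add: orth j)
      also have "\<dots> = x j"
        using j finite_index_set by simp
      finally show ?thesis by simp
    qed
    define b1 where "b1 = cyclic_prod (Suc n) (\<lambda>a t. 1) (\<lambda>a t. - (\<mu> a * (if a = Suc n then \<Lambda> else 1) * q ^ t))"
    define b2 where "b2 = cyclic_prod (Suc n) (\<lambda>a t. - (q ^ t)) (\<lambda>a t. if a = Suc n then \<Lambda> else 1)"
    have b1: "B1 q (Suc n) \<mu> i z \<Lambda> = b1 i z" and b2: "B2 q (Suc n) i z \<Lambda> = b2 i z"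
      if "\<forall>a\<in>{1..Suc n}. z a \<noteq> 0" for i z
      using B1_eq_cyclic_prod[OF that] B2_eq_cyclic_prod[OF that _ \<Lambda>]
      by (simp_all only: b1_def b2_def le_add1 plus_1_eq_Suc[symmetric])
    have "\<exists>x. \<forall>z. (\<forall>a\<in>{1..Suc n}. z a \<noteq> 0) \<longrightarrow>
        B1 q (Suc n) \<mu> i z \<Lambda> = (\<Sum>j\<in>?I. x j * B2 q (Suc n) j z \<Lambda>)" if i: "i \<in> ?I" for i
    proof -
      have "\<exists>x. b1 i = (\<Sum>j\<in>?I. (\<lambda>z. x j * b2 j z))"
      \<comment> \<open>The spanning monomials are an image of the index set, so they are at most as
        many as the members of the family \<open>b2\<close>.\<close>
      proof (rule polyfun.independent_family_spans[where T = "monomial (Suc n) ` ?I"])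
        show "b2 ` ?I \<subseteq> polyfun.span (monomial (Suc n) ` ?I)" "b1 i \<in> polyfun.span (monomial (Suc n) ` ?I)"
          using cyclic_prod_in_forms i by (auto simp: forms_def b1_def b2_def)
      next
        fix x assume "(\<Sum>j\<in>?I. (\<lambda>z. x j * b2 j z)) = 0"
        then have "(\<Sum>j\<in>?I. x j * b2 j z) = 0" for z
          by (metis sum_polyfun_apply zero_fun_apply)
        then have "x j = \<kappa> j * (\<Sum>k\<in>lower_seqs n j. W k j * 0)" if "j \<in> ?I" for j
          using that by (intro coeff) (simp_all add: b2)
        then show "\<forall>j\<in>?I. x j = 0" by simp
      qed (simp_all add: finite_index_set card_image_le)
      then obtain x where "b1 i = (\<Sum>j\<in>?I. (\<lambda>z. x j * b2 j z))" by blast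
      \<comment> \<open>The polynomial identity holds at every z and becomes the expansion of B1 in
        the B2 where no z_a vanishes.\<close>
      then have "b1 i z = (\<Sum>j\<in>?I. x j * b2 j z)" for z
        by (simp only: sum_polyfun_apply)
      then show ?thesis
        by (intro exI[of _ x]) (simp add: b1 b2)
    qed
    then have "\<forall>i\<in>?I. \<exists>x. \<forall>z. (\<forall>a\<in>{1..Suc n}. z a \<noteq> 0) \<longrightarrow>
        B1 q (Suc n) \<mu> i z \<Lambda> = (\<Sum>j\<in>?I. x j * B2 q (Suc n) j z \<Lambda>)" by blast
    from bchoice[OF this] have ex: "\<exists>R. \<forall>i\<in>?I. \<forall>z. (\<forall>a\<in>{1..Suc n}. z a \<noteq> 0) \<longrightarrow>
        B1 q (Suc n) \<mu> i z \<Lambda> = (\<Sum>j\<in>?I. R i j * B2 q (Suc n) j z \<Lambda>)" .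
    have "R i j = Cfactor l (Suc n) M c i j
            * (qpoch (\<Lambda> * s) q M / qpoch (\<Lambda> * q powi (1 - int M)) q M)
            * (\<Prod>a=1..Suc n. qpoch q q (i a) / qpoch q q (j a))
            * Acoef q l (Suc n) M \<Lambda> (\<lambda>a. c a - of_nat (i a)) i (\<lambda>a. c a - of_nat (j a)) j"
      if R: "\<forall>i\<in>?I. \<forall>z. (\<forall>a\<in>{1..Suc n}. z a \<noteq> 0) \<longrightarrow>
          B1 q (Suc n) \<mu> i z \<Lambda> = (\<Sum>j\<in>?I. R i j * B2 q (Suc n) j z \<Lambda>)"
        and i: "i \<in> ?I" and j: "j \<in> ?I" for R i j
    proof -
      have "R i j = \<kappa> j * (\<Sum>k\<in>lower_seqs n j. W k j * B1 q (Suc n) \<mu> i (zpt q k) \<Lambda>)"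
        using R i j by (intro coeff) auto
      also have "\<dots> = Cfactor l (Suc n) M c i j
            * (qpoch (\<Lambda> * s) q M / qpoch (\<Lambda> * q powi (1 - int M)) q M)
            * (\<Prod>a=1..Suc n. qpoch q q (i a) / qpoch q q (j a))
            * Acoef q l (Suc n) M \<Lambda> (\<lambda>a. c a - of_nat (i a)) i (\<lambda>a. c a - of_nat (j a)) j"
        unfolding \<kappa>_def W_def \<mu>_def s_def
        using elim i j
        by (intro coefficient_eq[where l = l, unfolded l, symmetric] q \<Lambda> \<nu>[unfolded s_def])
           (auto simp: s_def g_def mult.assoc)
      finally show ?thesis .
    qed
    then show ?case
      using ex unfolding N Let_def \<mu>_def s_def by blast
  qed
qed

end
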